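(* Suppose that $\Gamma$ is an $n$-vertex (simple) graph with matching number $\nu(\Gamma) = m$. If $\Gamma$ is not a vertex-disjoint union of copies of $K_2$, $K_3$, $K_4$ and $D_6$, then $\mathrm{mis}(\Gamma) < 2^{3m-n}3^{n-2m}$.
   Context: $\mathrm{mis}(\Gamma)$ denotes the number of maximal (with respect to inclusion) independent sets of $\Gamma$. $\nu(\Gamma)$ is the maximum size of a matching in $\Gamma$. $D_6$ denotes the graph consisting of two vertex-disjoint triangles joined by a single edge. No restriction on the size of $m$ relative to $n$ is imposed. *)

theory Defs
  imports Complex_Main
begin

record 'a ugraph =
  verts :: "'a set"
  edges :: "'a set set"

definition simple_graph :: "'a ugraph \<Rightarrow> bool" where
  "simple_graph G \<longleftrightarrow>
     finite (verts G) \<and> (\<forall>e\<in>edges G. e \<subseteq> verts G \<and> card e = 2)"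

definition independent_set :: "'a ugraph \<Rightarrow> 'a set \<Rightarrow> bool" where
  "independent_set G S \<longleftrightarrow> S \<subseteq> verts G \<and> (\<forall>u\<in>S. \<forall>v\<in>S. {u, v} \<notin> edges G)"

definition maximal_independent_set :: "'a ugraph \<Rightarrow> 'a set \<Rightarrow> bool" where
  "maximal_independent_set G S \<longleftrightarrow>
     independent_set G S \<and> (\<forall>T. independent_set G T \<and> S \<subseteq> T \<longrightarrow> T = S)"

definition mis :: "'a ugraph \<Rightarrow> nat" where
  "mis G = card {S. maximal_independent_set G S}"

definition matching :: "'a ugraph \<Rightarrow> 'a set set \<Rightarrow> bool" where
  "matching G M \<longleftrightarrow> M \<subseteq> edges G \<and> pairwise disjnt M"

definition matching_number :: "'a ugraph \<Rightarrow> nat" where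
  "matching_number G = Max {card M | M. matching G M}"

definition graph_iso :: "'a ugraph \<Rightarrow> 'b ugraph \<Rightarrow> bool" where
  "graph_iso G H \<longleftrightarrow>
     (\<exists>f. bij_betw f (verts G) (verts H) \<and> edges H = (\<lambda>e. f ` e) ` edges G)"

definition complete_graph :: "nat \<Rightarrow> nat ugraph" where
  "complete_graph k = \<lparr>verts = {..<k}, edges = {e. e \<subseteq> {..<k} \<and> card e = 2}\<rparr>"

text \<open>Two triangles on 0, 1, 2 and 3, 4, 5, joined by the edge between 2 and 3.\<close>

definition D6 :: "nat ugraph" where
  "D6 = \<lparr>verts = {..<6},
         edges = {{0, 1}, {0, 2}, {1, 2}, {3, 4}, {3, 5}, {4, 5}, {2, 3}}\<rparr>"

text \<open>The family \<open>C\<close> may be empty, so the graph without vertices is a disjoint union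
  of copies of any graphs.\<close>

definition disjoint_union_of_copies :: "'b ugraph set \<Rightarrow> 'a ugraph \<Rightarrow> bool" where
  "disjoint_union_of_copies \<H> G \<longleftrightarrow>
     (\<exists>C. (\<forall>A\<in>C. \<exists>H\<in>\<H>. graph_iso H A) \<and>
          pairwise (\<lambda>A B. disjnt (verts A) (verts B)) C \<and>
          verts G = (\<Union>A\<in>C. verts A) \<and>
          edges G = (\<Union>A\<in>C. edges A))"

end

theory Submission
  imports Defs
begin

text \<open>
  Write the bound as $W = (3/2)^n (8/9)^m$ and argue by induction over induced subgraphs, allowing
  an arbitrary matching in place of a maximum one. Deleting a set of vertices multiplies $W$ by at
  most $1/2$ for every matching edge inside the set, $2/3$ for every unmatched vertex and $3/4$ for
  every other vertex. A component $K_2$, $K_3$, $K_4$ or $D_6$ splits off with equality. If there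
  is no such component, the branchings
  $\mathrm{mis}(G) \le \mathrm{mis}(G - v) + \mathrm{mis}(G - N[v])$ and
  $\mathrm{mis}(G) \le \sum_{u \in N[v]} \mathrm{mis}(G - N[u])$ always lose: at isolated vertices
  and leaves, at vertices missed by a maximal matching, and, if the matching is perfect, at
  vertices of degree at least 4, of degree 2, or of a cubic graph. In the latter cases $G - v$
  has a vertex missed by the remaining matching, which accounts for the gain.
\<close>

text \<open>The adjacency relation stays fixed, so a graph is just a vertex set \<open>V\<close>,
  induced subgraphs are subsets and deleting vertices is set difference.\<close>

locale adjacency =
  fixes E :: "'a \<Rightarrow> 'a \<Rightarrow> bool"
  assumes adj_sym: "E x y \<Longrightarrow> E y x"
    and adj_irrefl [simp]: "\<not> E x x"
begin

section \<open>Branching on maximal independent sets\<close>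

definition nb :: "'a set \<Rightarrow> 'a \<Rightarrow> 'a set" where
  "nb V v = {u \<in> V. E v u}"

abbreviation cnb :: "'a set \<Rightarrow> 'a \<Rightarrow> 'a set" where
  "cnb V v \<equiv> insert v (nb V v)"

text \<open>Maximality is encoded as domination: every vertex outside \<open>S\<close> has a
  neighbour in \<open>S\<close>.\<close>

definition misets :: "'a set \<Rightarrow> 'a set set" where
  "misets V = {S. S \<subseteq> V \<and> (\<forall>u\<in>S. \<forall>w\<in>S. \<not> E u w) \<and> (\<forall>x\<in>V - S. \<exists>u\<in>S. E x u)}"

definition mi :: "'a set \<Rightarrow> real" where
  "mi V = real (card (misets V))"

lemma adj_commute: "E x y \<longleftrightarrow> E y x"
  using adj_sym by blast

lemma mem_nb [simp]: "u \<in> nb V v \<longleftrightarrow> u \<in> V \<and> E v u"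
  by (simp add: nb_def)

lemma finite_nb [simp]: "finite V \<Longrightarrow> finite (nb V v)"
  by (simp add: nb_def)

lemma nb_pairD:
  assumes "nb V v = {a, b}"
  shows "a \<in> V" "b \<in> V" "E v a" "E v b" "E a v" "E b v" "a \<noteq> v" "b \<noteq> v"
proof -
  have "a \<in> nb V v" "b \<in> nb V v"
    using assms by simp_all
  then show "a \<in> V" "b \<in> V" "E v a" "E v b" "E a v" "E b v" "a \<noteq> v" "b \<noteq> v"
    using adj_sym by auto
qed

lemma not_adj_if_nb_eq: "nb V v = A \<Longrightarrow> u \<in> V \<Longrightarrow> u \<notin> A \<Longrightarrow> \<not> E v u \<and> \<not> E u v"
  using adj_sym by auto

lemma nb_Diff: "nb (V - X) v = nb V v - X"
  by (auto simp: nb_def)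

lemma card_cnb [simp]: "finite V \<Longrightarrow> card (cnb V v) = Suc (card (nb V v))"
  by simp

lemma finite_misets [simp]: "finite V \<Longrightarrow> finite (misets V)"
  by (rule finite_subset[of _ "Pow V"]) (auto simp: misets_def)

lemma mi_empty: "mi {} = 1"
proof -
  have "misets {} = {{}}"
    by (auto simp: misets_def)
  then show ?thesis
    by (simp add: mi_def)
qed

text \<open>Removing \<open>u\<close> is injective on these sets and leaves a maximal independent
  set of \<open>V - cnb V u\<close>: a vertex not adjacent to \<open>u\<close> is dominated by
  another member of \<open>S\<close>.\<close>

lemma misets_containing:
  assumes "finite V" "u \<in> V"
  shows "real (card {S \<in> misets V. u \<in> S}) \<le> mi (V - cnb V u)"
proof -
  have "inj_on (\<lambda>S. S - {u}) {S \<in> misets V. u \<in> S}"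
    by (rule inj_onI) (auto simp: set_eq_iff)
  moreover have "S - {u} \<in> misets (V - cnb V u)" if S: "S \<in> misets V" "u \<in> S" for S
  proof -
    have ind: "S \<subseteq> V" "\<And>x y. x \<in> S \<Longrightarrow> y \<in> S \<Longrightarrow> \<not> E x y"
      using S(1) by (auto simp: misets_def)
    have "\<exists>y\<in>S - {u}. E x y" if x: "x \<in> V - cnb V u - (S - {u})" for x
    proof -
      have "x \<in> V - S" "\<not> E x u"
        using x S(2) adj_commute by auto
      moreover obtain y where "y \<in> S" "E x y"
        using S(1) \<open>x \<in> V - S\<close> unfolding misets_def by blast
      ultimately show ?thesis
        by blast
    qed
    with ind S(2) show ?thesis
      unfolding misets_def by auto
  qed
  ultimately have "card {S \<in> misets V. u \<in> S} \<le> card (misets (V - cnb V u))"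
    using assms(1) by (intro card_inj_on_le[of "\<lambda>S. S - {u}"]) auto
  then show ?thesis
    by (simp add: mi_def)
qed

text \<open>A maximal independent set that avoids \<open>v\<close> stays maximal once
  \<open>v\<close> is deleted; the others are counted by \<open>misets_containing\<close>.\<close>

lemma mi_branch_vertex:
  assumes "finite V" "v \<in> V"
  shows "mi V \<le> mi (V - {v}) + mi (V - cnb V v)"
proof -
  have "misets V \<subseteq> misets (V - {v}) \<union> {S \<in> misets V. v \<in> S}"
    by (auto simp: misets_def)
  then have "card (misets V) \<le> card (misets (V - {v}) \<union> {S \<in> misets V. v \<in> S})"
    using assms by (intro card_mono) auto
  also have "\<dots> \<le> card (misets (V - {v})) + card {S \<in> misets V. v \<in> S}"
    by (rule card_Un_le)
  finally have "mi V \<le> mi (V - {v}) + real (card {S \<in> misets V. v \<in> S})"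
    by (simp add: mi_def)
  with misets_containing[OF assms] show ?thesis
    by linarith
qed

text \<open>By domination, every maximal independent set meets the closed neighbourhood of
  \<open>v\<close>.\<close>

lemma mi_branch_nb:
  assumes "finite V" "v \<in> V"
  shows "mi V \<le> (\<Sum>u\<in>cnb V v. mi (V - cnb V u))"
proof -
  have "misets V \<subseteq> (\<Union>u\<in>cnb V v. {S \<in> misets V. u \<in> S})"
    using assms(2) by (fastforce simp: misets_def)
  then have "card (misets V) \<le> card (\<Union>u\<in>cnb V v. {S \<in> misets V. u \<in> S})"
    using assms by (intro card_mono) auto
  also have "\<dots> \<le> (\<Sum>u\<in>cnb V v. card {S \<in> misets V. u \<in> S})"
    using assms by (intro card_UN_le) auto
  finally have "mi V \<le> (\<Sum>u\<in>cnb V v. real (card {S \<in> misets V. u \<in> S}))"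
    unfolding mi_def of_nat_sum[symmetric] of_nat_le_iff .
  also have "\<dots> \<le> (\<Sum>u\<in>cnb V v. mi (V - cnb V u))"
    using assms by (intro sum_mono misets_containing) auto
  finally show ?thesis .
qed

lemma mi_isolated:
  assumes "finite V" "v \<in> V" "nb V v = {}"
  shows "mi V \<le> mi (V - {v})"
  using mi_branch_nb[OF assms(1,2)] assms(3) by simp

lemma mi_leaf:
  assumes "finite V" "v \<in> V" "nb V v = {z}"
  shows "mi V \<le> mi (V - {v, z}) + mi (V - cnb V z)"
proof -
  have "v \<noteq> z"
    using assms(3) by (metis adj_irrefl mem_nb singletonI)
  then show ?thesis
    using mi_branch_nb[OF assms(1,2)] assms(3) by simp
qed

lemma mi_deg2:
  assumes "finite V" "v \<in> V" "nb V v = {a, b}" "a \<noteq> b"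
  shows "mi V \<le> mi (V - cnb V v) + mi (V - cnb V a) + mi (V - cnb V b)"
proof -
  have "v \<noteq> a" "v \<noteq> b"
    using assms(3) by (metis adj_irrefl mem_nb insertCI)+
  then show ?thesis
    using mi_branch_nb[OF assms(1,2)] assms(3,4) by simp
qed

text \<open>All vertices of \<open>C\<close> have closed neighbourhood \<open>C\<close>, so every
  branch of \<open>mi_branch_nb\<close> is \<open>V - C\<close>.\<close>

lemma mi_clique_component:
  assumes "finite V" "C \<subseteq> V" "C \<noteq> {}" "\<And>x. x \<in> C \<Longrightarrow> nb V x = C - {x}"
  shows "mi V \<le> real (card C) * mi (V - C)"
proof -
  obtain v where v: "v \<in> C"
    using assms(3) by blast
  have c: "cnb V x = C" if "x \<in> C" for x
    using assms(4)[OF that] that by auto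
  have "mi V \<le> (\<Sum>u\<in>cnb V v. mi (V - cnb V u))"
    using v assms by (intro mi_branch_nb) auto
  also have "\<dots> = (\<Sum>u\<in>C. mi (V - C))"
    unfolding c[OF v] by (intro sum.cong) (simp_all add: c)
  finally show ?thesis
    by simp
qed

section \<open>The weight of a graph with a matching\<close>

definition mt :: "'a set \<Rightarrow> 'a set set \<Rightarrow> bool" where
  "mt V M \<longleftrightarrow> (\<forall>e\<in>M. \<exists>x y. e = {x, y} \<and> x \<in> V \<and> y \<in> V \<and> E x y) \<and> pairwise disjnt M"

definition W :: "'a set \<Rightarrow> 'a set set \<Rightarrow> real" where
  "W V M = (3/2) ^ card V * (8/9) ^ card M"

definition del :: "'a set \<Rightarrow> 'a set set \<Rightarrow> 'a set set" where
  "del X M = {e \<in> M. e \<inter> X = {}}"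

lemma W_pos [simp]: "0 < W V M"
  by (simp add: W_def)

lemma mt_finite: "mt V M \<Longrightarrow> finite V \<Longrightarrow> finite M"
  by (rule finite_subset[of _ "Pow V"]) (auto simp: mt_def)

lemma mt_del: "mt V M \<Longrightarrow> mt (V - X) (del X M)"
  unfolding mt_def del_def pairwise_def
  by (safe; fastforce)

lemma mt_unique: "mt V M \<Longrightarrow> e \<in> M \<Longrightarrow> f \<in> M \<Longrightarrow> x \<in> e \<Longrightarrow> x \<in> f \<Longrightarrow> e = f"
  by (auto simp: mt_def pairwise_def disjnt_iff)

lemma mt_edgeD: "mt V M \<Longrightarrow> {x, y} \<in> M \<Longrightarrow> E x y \<and> x \<in> V \<and> y \<in> V \<and> x \<noteq> y"
  by (auto simp: mt_def doubleton_eq_iff adj_commute dest!: bspec)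

lemma mt_partner:
  assumes "mt V M" "x \<in> \<Union>M"
  obtains y where "{x, y} \<in> M"
proof -
  obtain e where e: "e \<in> M" "x \<in> e"
    using assms(2) by blast
  then obtain u w where "e = {u, w}"
    using assms(1) by (auto simp: mt_def)
  with e that show thesis
    by (auto simp: insert_commute)
qed

lemma mt_partner_unique: "mt V M \<Longrightarrow> {x, y} \<in> M \<Longrightarrow> {x, z} \<in> M \<Longrightarrow> y = z"
  using mt_unique[of V M "{x, y}" "{x, z}" x] by (auto simp: doubleton_eq_iff)

lemma card_mt_edge: "mt V M \<Longrightarrow> e \<in> M \<Longrightarrow> card e = 2 \<and> finite e"
  by (fastforce simp: mt_def card_2_iff)

lemma card_Union_mt:
  assumes "mt V M" "P \<subseteq> M" "finite V"
  shows "card (\<Union>P) = 2 * card P"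
proof -
  have "card (\<Union>P) = (\<Sum>e\<in>P. card e)"
    using assms card_mt_edge[OF assms(1)]
    by (intro card_Union_disjoint) (auto simp: mt_def intro: pairwise_subset)
  also have "\<dots> = (\<Sum>e\<in>P. 2)"
    using assms card_mt_edge[OF assms(1)] by (intro sum.cong) auto
  finally show ?thesis
    by simp
qed

text \<open>A lost vertex contributes the factor 2/3 and a lost matching edge the factor 9/8; as 9/8
  > 1, an upper bound \<open>t\<close> on the number of lost edges is enough.\<close>

lemma W_del:
  assumes "finite V" "mt V M" "X \<subseteq> V" "card {e \<in> M. e \<inter> X \<noteq> {}} \<le> t"
  shows "W (V - X) (del X M) \<le> (2/3) ^ card X * (9/8) ^ t * W V M"
proof -
  define s where "s = card {e \<in> M. e \<inter> X \<noteq> {}}"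
  have fM: "finite M"
    using assms mt_finite by blast
  have "card M = card ({e \<in> M. e \<inter> X \<noteq> {}} \<union> del X M)"
    by (rule arg_cong[of _ _ card]) (auto simp: del_def)
  also have "\<dots> = s + card (del X M)"
    unfolding s_def using fM by (intro card_Un_disjoint) (auto simp: del_def)
  finally have m: "card M = s + card (del X M)" .
  have n: "card V = card X + card (V - X)"
    using assms by (metis card_Diff_subset card_mono finite_subset le_add_diff_inverse)
  have "(2/3) ^ card X * (9/8) ^ s * W V M
        = ((2/3) ^ card X * (3/2) ^ card X) * ((9/8) ^ s * (8/9) ^ s) * W (V - X) (del X M)"
    unfolding W_def m n power_add by (simp only: mult_ac)
  also have "\<dots> = W (V - X) (del X M)"
    unfolding power_mult_distrib[symmetric] by simp
  finally have "W (V - X) (del X M) = (2/3) ^ card X * (9/8) ^ s * W V M" ..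
  also have "\<dots> \<le> (2/3) ^ card X * (9/8) ^ t * W V M"
    using assms(4) less_imp_le[OF W_pos[of V M]] unfolding s_def[symmetric]
    by (intro mult_right_mono mult_left_mono power_increasing) auto
  finally show ?thesis .
qed

text \<open>\<open>P\<close> consists of matching edges inside \<open>X\<close>, \<open>U\<close> of unmatched vertices, and every one of the
  remaining \<open>k\<close> vertices destroys at most one matching edge.\<close>

lemma W_remove:
  assumes fV: "finite V" and mt: "mt V M" and X: "X \<subseteq> V"
    and P: "P \<subseteq> M" "\<Union>P \<subseteq> X" and U: "U \<subseteq> X" "U \<inter> \<Union>M = {}"
    and k: "2 * card P + card U + k \<le> card X"
  shows "W (V - X) (del X M) \<le> (1/2) ^ card P * (2/3) ^ card U * (3/4) ^ k * W V M"
proof -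
  define R where "R = X - \<Union>P - U"
  have fX: "finite X"
    using fV X finite_subset by blast
  have fM: "finite M"
    using fV mt mt_finite by blast
  have "X = \<Union>P \<union> (U \<union> R)"
    using P U by (auto simp: R_def)
  moreover have "card (\<Union>P \<union> (U \<union> R)) = card (\<Union>P) + (card U + card R)"
  proof -
    have "finite (\<Union>P)" "finite U" "finite R"
      using fX P U by (auto simp: R_def intro: finite_subset)
    moreover have "\<Union>P \<inter> U = {}"
      using P(1) U(2) by blast
    moreover have "\<Union>P \<inter> R = {}" "U \<inter> R = {}"
      by (auto simp: R_def)
    ultimately show ?thesis
      by (simp add: card_Un_disjoint Int_Un_distrib)
  qed
  ultimately have cX: "card X = 2 * card P + card U + card R"
    using card_Union_mt[OF mt P(1) fV] by simp
  \<comment> \<open>An edge outside \<open>P\<close> that meets \<open>X\<close> does so in a vertex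
    of \<open>R\<close>, and this vertex determines the edge, so at most \<open>card R\<close> such
    edges are lost.\<close>
  have "{e \<in> M. e \<inter> X \<noteq> {}} \<subseteq> P \<union> (\<lambda>x. SOME e. e \<in> M \<and> x \<in> e) ` R"
  proof
    fix e
    assume e: "e \<in> {e \<in> M. e \<inter> X \<noteq> {}}"
    then obtain x where x: "x \<in> e" "x \<in> X"
      by blast
    show "e \<in> P \<union> (\<lambda>x. SOME e. e \<in> M \<and> x \<in> e) ` R"
    proof (cases "e \<in> P")
      case False
      have "(SOME e. e \<in> M \<and> x \<in> e) = e"
        using e x mt_unique[OF mt] by (intro some_equality) auto
      moreover have "x \<in> R"
        using e x False P U mt_unique[OF mt] by (auto simp: R_def) blast
      ultimately show ?thesis
        by force
    qed simp
  qed
  then have "card {e \<in> M. e \<inter> X \<noteq> {}} \<le> card (P \<union> (\<lambda>x. SOME e. e \<in> M \<and> x \<in> e) ` R)"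
    using fX fM P(1) by (intro card_mono) (auto simp: R_def intro: finite_subset)
  also have "\<dots> \<le> card P + card ((\<lambda>x. SOME e. e \<in> M \<and> x \<in> e) ` R)"
    by (rule card_Un_le)
  also have "\<dots> \<le> card P + card R"
    using fX by (intro add_left_mono card_image_le) (auto simp: R_def)
  finally have t: "card {e \<in> M. e \<inter> X \<noteq> {}} \<le> card P + card R" .
  \<comment> \<open>A matched pair is charged (2/3)^2 * 9/8 = 1/2, an unmatched vertex 2/3 and a
    vertex of \<open>R\<close> 2/3 * 9/8 = 3/4.\<close>
  have "(2/3::real) ^ card X * (9/8) ^ (card P + card R)
      = ((2/3) ^ 2 * (9/8)) ^ card P * (2/3) ^ card U * ((2/3) * (9/8)) ^ card R"
    unfolding cX power_add power_mult power_mult_distrib by (simp only: mult_ac)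
  also have "\<dots> = (1/2) ^ card P * (2/3) ^ card U * (3/4) ^ card R"
    by (simp add: power2_eq_square)
  also have "\<dots> \<le> (1/2) ^ card P * (2/3) ^ card U * (3/4) ^ k"
    using k cX by (intro mult_left_mono power_decreasing) auto
  finally have "(2/3::real) ^ card X * (9/8) ^ (card P + card R)
      \<le> (1/2) ^ card P * (2/3) ^ card U * (3/4) ^ k" .
  from mult_right_mono[OF this less_imp_le[OF W_pos[of V M]]] W_del[OF fV mt X t]
  show ?thesis
    by linarith
qed

text \<open>The induction hypothesis. It covers all matchings, since \<open>del X M\<close> need not
  be maximum even if \<open>M\<close> is.\<close>

definition bounded_below :: "'a set \<Rightarrow> bool" where
  "bounded_below V \<longleftrightarrow> finite V \<and> (\<forall>U M. U \<subset> V \<longrightarrow> mt U M \<longrightarrow> mi U \<le> W U M)"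

lemma bounded_below_Diff: "bounded_below V \<Longrightarrow> bounded_below (V - X)"
  unfolding bounded_below_def by blast

lemma bounded_belowD: "bounded_below V \<Longrightarrow> X \<subseteq> V \<Longrightarrow> X \<noteq> {} \<Longrightarrow> mt V M
   \<Longrightarrow> mi (V - X) \<le> W (V - X) (del X M)"
  unfolding bounded_below_def using mt_del by blast

lemma mi_remove:
  assumes "bounded_below V" "mt V M" "X \<subseteq> V" "X \<noteq> {}"
    and "P \<subseteq> M" "\<Union>P \<subseteq> X" "U \<subseteq> X" "U \<inter> \<Union>M = {}"
    and "2 * card P + card U + k \<le> card X"
  shows "mi (V - X) \<le> (1/2) ^ card P * (2/3) ^ card U * (3/4) ^ k * W V M"
  using bounded_belowD[OF assms(1,3,4,2)] W_remove[OF _ assms(2,3,5-9)] assms(1)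
  by (fastforce simp: bounded_below_def)

lemma mi_remove_edge:
  assumes "bounded_below V" "mt V M" "X \<subseteq> V" "{a, b} \<in> M" "a \<in> X" "b \<in> X" "k + 2 \<le> card X"
  shows "mi (V - X) \<le> 1/2 * (3/4) ^ k * W V M"
  using mi_remove[OF assms(1-3), of "{{a, b}}" "{}" k] assms by auto

lemma mi_remove_two_edges:
  assumes "bounded_below V" "mt V M" "X \<subseteq> V" "{a, b} \<in> M" "a \<in> X" "b \<in> X"
    and "{c, d} \<in> M" "c \<in> X" "d \<in> X" "{a, b} \<noteq> {c, d}" "k + 4 \<le> card X"
  shows "mi (V - X) \<le> 1/4 * (3/4) ^ k * W V M"
  using mi_remove[OF assms(1-3), of "{{a, b}, {c, d}}" "{}" k] assms
  by (auto simp: power2_eq_square)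

lemma mi_remove_free:
  assumes "bounded_below V" "mt V M" "X \<subseteq> V" "u \<in> X" "u \<notin> \<Union>M" "k + 1 \<le> card X"
  shows "mi (V - X) \<le> 2/3 * (3/4) ^ k * W V M"
  using mi_remove[OF assms(1-3), of "{}" "{u}" k] assms by auto

lemma mi_remove_free_edge:
  assumes "bounded_below V" "mt V M" "X \<subseteq> V" "u \<in> X" "u \<notin> \<Union>M"
    and "{a, b} \<in> M" "a \<in> X" "b \<in> X" "k + 3 \<le> card X"
  shows "mi (V - X) \<le> 1/3 * (3/4) ^ k * W V M"
  using mi_remove[OF assms(1-3), of "{{a, b}}" "{u}" k] assms by auto

text \<open>Both branches of \<open>mi_leaf\<close> delete \<open>v\<close> and \<open>z\<close>. If
  \<open>v\<close> is matched, its partner is \<open>z\<close>, a factor 1/2; otherwise 2/3 for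
  \<open>v\<close> and 3/4 for \<open>z\<close> give 1/2 as well. The second branch also deletes at
  least \<open>d\<close> further neighbours of \<open>z\<close>.\<close>

lemma mi_leaf_bound:
  assumes bb: "bounded_below V" and mt: "mt V M" and v: "v \<in> V" and nbv: "nb V v = {z}"
    and d: "d + 1 \<le> card (nb V z)"
  shows "mi V \<le> (1/2 + 1/2 * (3/4) ^ d) * W V M"
proof -
  have fV: "finite V"
    using bb by (simp add: bounded_below_def)
  have z: "z \<in> V" "E v z" "z \<noteq> v" "E z v"
    using nbv v by (auto simp: adj_commute set_eq_iff nb_def)
  have r: "mi (V - X) \<le> 1/2 * (3/4) ^ k * W V M"
    if X: "X \<subseteq> V" "v \<in> X" "z \<in> X" "k + 2 \<le> card X" for X k
  proof (cases "v \<in> \<Union>M")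
    case True
    then obtain y where y: "{v, y} \<in> M"
      using mt mt_partner by blast
    then have "y = z"
      using mt_edgeD[OF mt y] nbv by (auto simp: set_eq_iff)
    then show ?thesis
      using mi_remove_edge[OF bb mt X(1)] y X by blast
  next
    case False
    show ?thesis
      using mi_remove_free[OF bb mt X(1,2) False, of "k + 1"] X(4) by simp
  qed
  have "mi (V - {v, z}) \<le> 1/2 * (3/4) ^ 0 * W V M"
    using v z by (intro r) auto
  moreover have "mi (V - cnb V z) \<le> 1/2 * (3/4) ^ d * W V M"
    using v z d fV by (intro r) auto
  ultimately show ?thesis
    using mi_leaf[OF fV v nbv] by (simp add: algebra_simps)
qed

section \<open>An unmatched vertex of degree two\<close>

lemma W_remove_vertex:
  assumes "finite V" "mt V M" "v \<in> V"
  shows "W (V - {v}) (del {v} M) \<le> 3/4 * W V M"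
  using W_remove[OF assms(1,2), of "{v}" "{}" "{}" 1] assms(3) by simp

lemma W_remove_free:
  assumes "finite V" "mt V M" "v \<in> V" "v \<notin> \<Union>M"
  shows "W (V - {v}) (del {v} M) \<le> 2/3 * W V M"
  using W_remove[OF assms(1,2), of "{v}" "{}" "{v}" 0] assms(3,4) by simp

lemma cnb_subset: "v \<in> V \<Longrightarrow> cnb V v \<subseteq> V"
  by auto

lemma card_ge: "A \<subseteq> B \<Longrightarrow> finite B \<Longrightarrow> card A = k \<Longrightarrow> k \<le> card B"
  using card_mono by blast

lemma nb_eq_pair:
  assumes "finite V" "card (nb V v) = 2" "a \<in> nb V v" "b \<in> nb V v" "a \<noteq> b"
  shows "nb V v = {a, b}"
  using card_subset_eq[of "nb V v" "{a, b}"] assms by simp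

lemma nb_eq_triple:
  assumes "finite V" "card (nb V v) = 3" "a \<in> nb V v" "b \<in> nb V v" "c \<in> nb V v"
    and "a \<noteq> b" "a \<noteq> c" "b \<noteq> c"
  shows "nb V v = {a, b, c}"
  using card_subset_eq[of "nb V v" "{a, b, c}"] assms by simp

lemma nb_obtain_second:
  assumes "finite V" "card (nb V v) = 2" "a \<in> nb V v"
  obtains b where "nb V v = {a, b}" "a \<noteq> b"
  using assms by (metis card_2_iff insertE insert_commute singletonD)

text \<open>The factor 23/24 is not good enough for cubic graphs, as 3/4 * 23/24 + 9/32 = 1; there the two
  vertices \<open>c\<close> and \<open>c'\<close> of the last alternative are both adjacent to the deleted vertex,
  which improves 9/32 to 1/4.\<close>

lemma free_vertex_degree_two:
  assumes bb: "bounded_below V" and mt: "mt V M" and v: "v \<in> V" "v \<notin> \<Union>M"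
    and nbv: "nb V v = {a, b}" "a \<noteq> b" and ab: "a \<in> \<Union>M" "b \<in> \<Union>M"
    and mindeg: "\<And>x. x \<in> V \<Longrightarrow> 2 \<le> card (nb V x)"
  shows "E a b \<and> nb V a = {v, b} \<and> nb V b = {v, a} \<or> mi V \<le> 11/12 * W V M \<or>
    mi V \<le> 23/24 * W V M \<and>
      (\<exists>c c'. c \<in> nb V v \<and> {c, c'} \<in> M \<and> card (nb V c) = 2 \<and> card (nb V c') = 2)"
proof -
  have fV: "finite V"
    using bb by (simp add: bounded_below_def)
  have W0: "0 < W V M"
    by simp
  have inV: "a \<in> V" "b \<in> V" "E v a" "E v b" "E a v" "E b v" "v \<noteq> a" "v \<noteq> b"
    using nb_pairD[OF nbv(1)] by auto
  obtain a' where a': "{a, a'} \<in> M"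
    using mt ab(1) by (rule mt_partner)
  obtain b' where b': "{b, b'} \<in> M"
    using mt ab(2) by (rule mt_partner)
  have a'V: "E a a'" "a' \<in> V" "a \<noteq> a'" "E a' a" and b'V: "E b b'" "b' \<in> V" "b \<noteq> b'" "E b' b"
    using mt_edgeD[OF mt a'] mt_edgeD[OF mt b'] by (auto simp: adj_commute)
  have va': "v \<noteq> a'" "v \<noteq> b'"
    using v a' b' by auto
  have branch: "mi V \<le> mi (V - cnb V v) + mi (V - cnb V a) + mi (V - cnb V b)"
    using fV v(1) nbv by (rule mi_deg2)
  have cv: "card (cnb V v) = 3"
    using nbv inV by simp
  \<comment> \<open>The unmatched \<open>v\<close> together with \<open>a\<close> and
    \<open>b\<close>: 2/3 * (3/4)^2 = 3/8.\<close>
  have Nv: "mi (V - cnb V v) \<le> 3/8 * W V M"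
    using mi_remove_free[OF bb mt cnb_subset[OF v(1)] _ v(2), of 2] cv
    by (simp add: power2_eq_square)
  \<comment> \<open>The deleted set contains the unmatched \<open>v\<close> and the matching edge at
    \<open>u\<close>: 2/3 * 1/2 = 1/3.\<close>
  have Nu: "mi (V - cnb V u) \<le> 1/3 * (3/4) ^ k * W V M"
    if "u \<in> V" "E u v" "{u, w} \<in> M" "k + 2 \<le> card (nb V u)" for u w k
    using mi_remove_free_edge[OF bb mt cnb_subset[OF that(1)] _ v(2) that(3), of k]
      that mt_edgeD[OF mt that(3)] v fV by auto
  show ?thesis
  proof (cases "E a b")
    case True
    then have Eba: "E b a"
      using adj_sym by blast
    show ?thesis
    proof (cases "{a, b} \<in> M")
      case M: True
      then have M': "{b, a} \<in> M"
        by (simp add: insert_commute)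
      have Nv': "mi (V - cnb V v) \<le> 1/3 * W V M"
        using mi_remove_free_edge[OF bb mt cnb_subset[OF v(1)] _ v(2) M, of 0] cv nbv
        by simp
      \<comment> \<open>Two vertices of degree 2 close off a triangle; otherwise one branch improves
        to 1/4, and 1/3 + 1/3 + 1/4 = 11/12.\<close>
      consider "card (nb V a) = 2" "card (nb V b) = 2" | "3 \<le> card (nb V a)" | "3 \<le> card (nb V b)"
        using mindeg[OF inV(1)] mindeg[OF inV(2)] by linarith
      then show ?thesis
      proof cases
        case 1
        then show ?thesis
          using nb_eq_pair[OF fV 1(1), of v b] nb_eq_pair[OF fV 1(2), of v a] True Eba inV v by simp
      next
        case 2
        have "mi (V - cnb V a) \<le> 1/4 * W V M"
          using Nu[OF inV(1,5) M, of 1] 2 by simp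
        moreover have "mi (V - cnb V b) \<le> 1/3 * W V M"
          using Nu[OF inV(2,6) M', of 0] mindeg[OF inV(2)] by simp
        ultimately show ?thesis
          using branch Nv' W0 by simp
      next
        case 3
        have "mi (V - cnb V b) \<le> 1/4 * W V M"
          using Nu[OF inV(2,6) M', of 1] 3 by simp
        moreover have "mi (V - cnb V a) \<le> 1/3 * W V M"
          using Nu[OF inV(1,5) M, of 0] mindeg[OF inV(1)] by simp
        ultimately show ?thesis
          using branch Nv' W0 by simp
      qed
    next
      case False
      \<comment> \<open>Now \<open>a\<close> and \<open>b\<close> each have three neighbours, namely
        \<open>v\<close>, one another and their partners, and 3/8 + 1/4 + 1/4 = 7/8.\<close>
      then have "b \<noteq> a'" "a \<noteq> b'"
        using a' b' by (auto simp: insert_commute)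
      then have "3 \<le> card (nb V a)" "3 \<le> card (nb V b)"
        using card_ge[of "{v, b, a'}" "nb V a" 3] card_ge[of "{v, a, b'}" "nb V b" 3]
          inV v a'V b'V va' True Eba nbv(2) fV by auto
      then have "mi (V - cnb V a) \<le> 1/4 * W V M" "mi (V - cnb V b) \<le> 1/4 * W V M"
        using Nu[OF inV(1,5) a', of 1] Nu[OF inV(2,6) b', of 1] by simp_all
      then show ?thesis
        using branch Nv W0 by linarith
    qed
  next
    case nab: False
    \<comment> \<open>Once \<open>v\<close> is deleted, \<open>c\<close> is a leaf at its partner
      \<open>c'\<close>. Branching at \<open>v\<close> gives 7/8 * 2/3 + 3/8 = 23/24, or 25/32 * 2/3
      + 3/8 = 43/48 if \<open>c'\<close> has degree at least 3.\<close>
    have leaf: "mi V \<le> 11/12 * W V M \<or> mi V \<le> 23/24 * W V M \<and>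
        card (nb V c) = 2 \<and> card (nb V c') = 2"
      if c: "nb V v = {c, d}" "c \<noteq> d" "\<not> E c d" "{c, c'} \<in> M" "card (nb V c) = 2" for c c' d
    proof -
      have cV: "c \<in> V" "E c v" "E c c'" "c' \<in> V" "c \<noteq> c'" "c' \<noteq> v" "c \<noteq> v"
        using c(4) nb_pairD[OF c(1)] mt_edgeD[OF mt c(4)] v by auto
      have "nb V c = {v, c'}"
        using nb_eq_pair[OF fV c(5), of v c'] cV v by simp
      then have l: "nb (V - {v}) c = {c'}"
        using cV by (auto simp: nb_Diff)
      have "\<not> E c' v"
        using c cV adj_commute by (metis insertE mem_nb singletonD)
      then have n: "nb (V - {v}) c' = nb V c'"
        by (auto simp: nb_Diff)
      have bound: "mi V \<le> ((1/2 + 1/2 * (3/4) ^ k) * (2/3) + 3/8) * W V M"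
        if k: "k + 1 \<le> card (nb V c')" for k
      proof -
        have "mi (V - {v}) \<le> (1/2 + 1/2 * (3/4) ^ k) * W (V - {v}) (del {v} M)"
          using mi_leaf_bound[OF bounded_below_Diff[OF bb] mt_del[OF mt] _ l] cV n k by simp
        also have "\<dots> \<le> (1/2 + 1/2 * (3/4) ^ k) * (2/3 * W V M)"
          using fV mt v by (intro mult_left_mono W_remove_free) auto
        finally show ?thesis
          using mi_branch_vertex[OF fV v(1)] Nv by (simp add: algebra_simps)
      qed
      consider "card (nb V c') = 2" | "3 \<le> card (nb V c')"
        using mindeg[OF cV(4)] by linarith
      then show ?thesis
      proof cases
        case 1
        then show ?thesis
          using bound[of 1] c by simp
      next
        case 2
        then have "mi V \<le> 43/48 * W V M"
          using bound[of 2] by (simp add: power2_eq_square)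
        then show ?thesis
          using W0 by linarith
      qed
    qed
    consider "card (nb V a) = 2" | "card (nb V b) = 2" | "3 \<le> card (nb V a)" "3 \<le> card (nb V b)"
      using mindeg[OF inV(1)] mindeg[OF inV(2)] by linarith
    then show ?thesis
    proof cases
      case 1
      then show ?thesis
        using leaf[OF nbv nab a'] a' nbv by blast
    next
      case 2
      have "nb V v = {b, a}" "b \<noteq> a" "\<not> E b a"
        using nbv nab by (auto simp: adj_commute)
      then show ?thesis
        using leaf[OF _ _ _ b' 2, of a] 2 b' by blast
    next
      case 3
      then have "mi (V - cnb V a) \<le> 1/4 * W V M" "mi (V - cnb V b) \<le> 1/4 * W V M"
        using Nu[OF inV(1,5) a', of 1] Nu[OF inV(2,6) b', of 1] by simp_all
      then show ?thesis
        using branch Nv W0 by linarith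
    qed
  qed
qed

section \<open>Perfect matchings\<close>

text \<open>Neighbourhoods are taken in \<open>V\<close>, so \<open>C\<close> is a whole component
  and not merely a clique.\<close>

definition clique_comp :: "'a set \<Rightarrow> 'a set \<Rightarrow> bool" where
  "clique_comp V C \<longleftrightarrow> C \<subseteq> V \<and> card C \<in> {2, 3, 4} \<and> (\<forall>x\<in>C. nb V x = C - {x})"

text \<open>The edge between \<open>c\<close> and \<open>d\<close> joins the two triangles.\<close>

definition D6_comp :: "'a set \<Rightarrow> 'a set \<Rightarrow> bool" where
  "D6_comp V C \<longleftrightarrow> (\<exists>a b c d e f. distinct [a, b, c, d, e, f] \<and> C = {a, b, c, d, e, f} \<and> C \<subseteq> V \<and>
     nb V a = {b, c} \<and> nb V b = {a, c} \<and> nb V c = {a, b, d} \<and>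
     nb V d = {c, e, f} \<and> nb V e = {d, f} \<and> nb V f = {d, e})"

lemma D6_compI:
  assumes "distinct [a, b, c, d, e, f]" "{a, b, c, d, e, f} \<subseteq> V"
    and "nb V a = {b, c}" "nb V b = {a, c}" "nb V c = {a, b, d}"
    and "nb V d = {c, e, f}" "nb V e = {d, f}" "nb V f = {d, e}"
  shows "D6_comp V {a, b, c, d, e, f}"
  unfolding D6_comp_def using assms by (intro exI conjI) (assumption | rule refl)+

text \<open>Apart from \<open>x\<close>, the set \<open>X\<close> consists of whole matching edges,
  so \<open>y\<close> is the only surviving vertex that loses its partner.\<close>

lemma Union_del:
  assumes mt: "mt V M" and perfect: "\<Union>M = V" and xy: "{x, y} \<in> M" "x \<in> X" "y \<notin> X"
    and closed: "\<And>u w. u \<in> X \<Longrightarrow> u \<noteq> x \<Longrightarrow> {u, w} \<in> M \<Longrightarrow> w \<in> X"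
  shows "\<Union>(del X M) = V - X - {y}"
proof (intro set_eqI iffI)
  fix z
  assume "z \<in> \<Union>(del X M)"
  then obtain e where e: "e \<in> M" "e \<inter> X = {}" "z \<in> e"
    by (auto simp: del_def)
  then have "z \<noteq> y"
    using mt_unique[OF mt e(1) xy(1), of z] xy(2) by auto
  then show "z \<in> V - X - {y}"
    using e perfect by auto
next
  fix z
  assume z: "z \<in> V - X - {y}"
  then obtain z' where z': "{z, z'} \<in> M"
    using mt_partner[OF mt] perfect by (metis DiffD1)
  then have z'': "{z', z} \<in> M"
    by (simp add: insert_commute)
  have "z' \<notin> X"
  proof
    assume "z' \<in> X"
    show False
    proof (cases "z' = x")
      case True
      then show False
        using mt_partner_unique[OF mt xy(1)] z'' z by auto
    next
      case False
      then show False
        using closed[OF \<open>z' \<in> X\<close> False z''] z by simp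
    qed
  qed
  then show "z \<in> \<Union>(del X M)"
    using z' z unfolding del_def by blast
qed

text \<open>Without \<open>x\<close> the vertices \<open>v\<close>, \<open>v'\<close> form a
  component \<open>K2\<close>, a factor 2 on the rest \<open>H\<close>; deleting
  \<open>cnb V x\<close> destroys two matching edges. Since 2 * 3/8 + 1/4 = 1, any constant gain on
  \<open>H\<close> wins, and it comes from \<open>y\<close>, the only unmatched vertex of
  \<open>H\<close>.\<close>

lemma pendant_triangle_strict:
  assumes bb: "bounded_below V" and mt: "mt V M" and perfect: "\<Union>M = V"
    and mindeg: "\<And>u. u \<in> V \<Longrightarrow> 2 \<le> card (nb V u)"
    and maxdeg: "\<And>u. u \<in> V \<Longrightarrow> card (nb V u) \<le> 3"
    and no_D6: "\<And>C. \<not> D6_comp V C"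
    and M: "{v, v'} \<in> M" "{x, y} \<in> M" and dist: "v \<noteq> x" "v' \<noteq> x" "y \<noteq> v" "y \<noteq> v'"
    and nbs: "nb V v = {v', x}" "nb V v' = {v, x}" "nb V x = {v, v', y}"
  shows "mi V < W V M"
proof -
  have fV: "finite V"
    using bb by (simp add: bounded_below_def)
  have W0: "0 < W V M"
    by simp
  have inV: "v \<in> V" "v' \<in> V" "v \<noteq> v'" "x \<in> V" "y \<in> V" "x \<noteq> y" "E x y" "E y x"
    using mt_edgeD[OF mt M(1)] mt_edgeD[OF mt M(2)] by (auto simp: adj_commute)
  define X where "X = {v, v', x}"
  have X: "X \<subseteq> V" "card X = 3"
    using inV dist by (auto simp: X_def)
  define H where "H = V - X"
  define N where "N = del X M"
  have bbH: "bounded_below H" and mtH: "mt H N"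
    unfolding H_def N_def using bb mt by (simp_all add: bounded_below_Diff mt_del)
  have "cnb V x = {x, v, v', y}"
    using nbs by simp
  then have Nx: "mi (V - cnb V x) \<le> 1/4 * W V M"
    using mi_remove_two_edges[OF bb mt cnb_subset[OF inV(4)] M(1) _ _ M(2), of 0] inV dist
    by (auto simp: doubleton_eq_iff)
  have "mi (V - {x}) \<le> real (card {v, v'}) * mi (V - {x} - {v, v'})"
    using fV inV dist nbs by (intro mi_clique_component) (auto simp: nb_Diff)
  moreover have "V - {x} - {v, v'} = H"
    by (auto simp: H_def X_def)
  ultimately have "mi (V - {x}) \<le> 2 * mi H"
    using inV by simp
  then have branch: "mi V \<le> 2 * mi H + 1/4 * W V M"
    using mi_branch_vertex[OF fV inV(4)] Nx by linarith
  have "W H N \<le> 3/8 * W V M"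
    using W_remove[OF fV mt X(1), of "{{v, v'}}" "{}" 1] M(1) X(2) by (simp add: H_def N_def X_def)
  then have suff: "mi V < W V M" if "mi H \<le> 23/24 * W H N"
    using that branch W0 by linarith
  have yH: "y \<in> H" "y \<notin> X"
    using inV dist by (auto simp: H_def X_def)
  have UN: "\<Union>N = H - {y}"
    unfolding H_def N_def
  proof (rule Union_del[OF mt perfect M(2) _ yH(2)])
    fix u w
    assume "u \<in> X" "u \<noteq> x" "{u, w} \<in> M"
    moreover have "{v', v} \<in> M"
      using M(1) by (simp add: insert_commute)
    ultimately show "w \<in> X"
      using mt_partner_unique[OF mt] M(1) unfolding X_def by blast
  qed (simp add: X_def)
  \<comment> \<open>The deleted vertices have no neighbours besides each other and \<open>y\<close>,
    so only \<open>y\<close> loses degree.\<close>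
  have nbH: "nb H u = nb V u" if "u \<in> H" "u \<noteq> y" for u
  proof -
    have "u \<notin> nb V w" if "w \<in> X" for w
      using that \<open>u \<in> H\<close> \<open>u \<noteq> y\<close> unfolding X_def H_def by (elim insertE) (simp_all add: nbs)
    then have "\<not> E u w" if "w \<in> X" for w
      using that \<open>u \<in> H\<close> by (auto simp: H_def dest: adj_sym)
    then show ?thesis
      by (auto simp: H_def nb_Diff)
  qed
  have nby: "nb H y = nb V y - {x}"
  proof -
    have "y \<notin> nb V v" "y \<notin> nb V v'"
      using dist inV by (simp_all add: nbs)
    then have "\<not> E y v" "\<not> E y v'"
      using inV(5) by (auto dest: adj_sym)
    then show ?thesis
      by (auto simp: H_def X_def nb_Diff)
  qed
  have cy: "card (nb H y) = card (nb V y) - 1"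
    using nby inV fV by simp
  have degH: "2 \<le> card (nb H u)" if "u \<in> H" "u \<noteq> y" for u
    using mindeg[of u] nbH[OF that] that by (simp add: H_def)
  consider "card (nb H y) = 1" | "card (nb H y) = 2"
    using cy mindeg[OF inV(5)] maxdeg[OF inV(5)] by linarith
  then show ?thesis
  proof cases
    case 1
    then obtain z where z: "nb H y = {z}"
      by (auto simp: card_1_singleton_iff)
    then have "z \<in> H" "z \<noteq> y"
      using nb_pairD[of H y z z] by simp_all
    then have "mi H \<le> 7/8 * W H N"
      using mi_leaf_bound[OF bbH mtH yH(1) z, of 1] degH[of z] by simp
    then show ?thesis
      using suff less_imp_le[OF W_pos[of H N]] by linarith
  next
    case 2
    then obtain a b where ab: "nb H y = {a, b}" "a \<noteq> b"
      by (auto simp: card_2_iff)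
    then have abH: "a \<in> H" "b \<in> H" "a \<noteq> y" "b \<noteq> y"
      using nb_pairD[OF ab(1)] by simp_all
    have "2 \<le> card (nb H u)" if "u \<in> H" for u
      using degH[OF that] 2 by (cases "u = y") auto
    moreover have "y \<notin> \<Union>N" "a \<in> \<Union>N" "b \<in> \<Union>N"
      using UN abH by auto
    ultimately have alt: "E a b \<and> nb H a = {y, b} \<and> nb H b = {y, a} \<or> mi H \<le> 11/12 * W H N \<or>
        mi H \<le> 23/24 * W H N"
      using free_vertex_degree_two[OF bbH mtH yH(1) _ ab] by blast
    consider "nb H a = {y, b}" "nb H b = {y, a}" | "mi H \<le> 23/24 * W H N"
    proof -
      have "mi H \<le> 23/24 * W H N" if "mi H \<le> 11/12 * W H N"
        using that W_pos[of H N] by linarith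
      then show thesis
        using alt that by blast
    qed
    then show ?thesis
    proof cases
      case 1
      \<comment> \<open>The triangle \<open>y\<close>, \<open>a\<close>, \<open>b\<close> and the
        triangle \<open>v\<close>, \<open>v'\<close>, \<open>x\<close>, joined by the edge between
        \<open>x\<close> and \<open>y\<close>, form a component \<open>D6\<close>.\<close>
      have "nb V y = {x, a, b}"
        using nby ab(1) inV insert_Diff[of x "nb V y"] by simp
      moreover have "nb V a = {y, b}" "nb V b = {y, a}"
        using 1 nbH abH by simp_all
      moreover have "distinct [v, v', x, y, a, b]" "{v, v', x, y, a, b} \<subseteq> V"
        using inV dist abH ab(2) by (auto simp: H_def X_def)
      ultimately have "D6_comp V {v, v', x, y, a, b}"
        using nbs by (intro D6_compI)
      with no_D6 show ?thesis
        by blast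
    qed (rule suff)
  qed
qed

section \<open>Degrees in a perfectly matched graph with \<open>W V M \<le> mi V\<close>\<close>

context
  fixes V :: "'a set" and M :: "'a set set"
  assumes bb: "bounded_below V" and mt: "mt V M" and perfect: "\<Union>M = V"
    and mindeg: "\<And>u. u \<in> V \<Longrightarrow> 2 \<le> card (nb V u)"
    and no_D6: "\<And>C. \<not> D6_comp V C"
    and tight: "W V M \<le> mi V"
begin

lemma tight_finite: "finite V"
  using bb by (simp add: bounded_below_def)

lemma tight_partner: "\<exists>v'. {v, v'} \<in> M" if "v \<in> V" for v
  using mt_partner[OF mt] that perfect by metis

lemma tight_branch: "mi V \<le> mi (V - {v}) + mi (V - cnb V v)" if "v \<in> V" for v
  using mi_branch_vertex[OF tight_finite that] .

lemma tight_remove_vertex: "mi (V - {v}) \<le> 3/4 * W V M" if "v \<in> V" for v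
  using mi_remove[OF bb mt, of "{v}" "{}" "{}" 1] that by simp

lemma tight_remove_cnb: "mi (V - cnb V v) \<le> 1/2 * (3/4) ^ k * W V M"
  if "v \<in> V" "k + 1 \<le> card (nb V v)" for v k
proof -
  obtain v' where v': "{v, v'} \<in> M"
    using tight_partner[OF \<open>v \<in> V\<close>] by blast
  then show ?thesis
    using mi_remove_edge[OF bb mt cnb_subset[OF \<open>v \<in> V\<close>] v', of k] mt_edgeD[OF mt v'] that tight_finite by auto
qed

text \<open>Branching at a vertex of degree at least 4 would give 3/4 + 1/2 * (3/4)^3 = 123/128. For
  degree 3 the same sum is 3/4 + 9/32 > 1, so cubic graphs need a finer argument.\<close>

lemma tight_max_degree: "card (nb V v) \<le> 3" if v: "v \<in> V" for v
proof (rule ccontr)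
  assume "\<not> card (nb V v) \<le> 3"
  then have "mi (V - cnb V v) \<le> 1/2 * (3/4) ^ 3 * W V M"
    by (intro tight_remove_cnb v) simp
  then show False
    using tight_branch[OF v] tight_remove_vertex[OF v] tight W_pos[of V M] by (simp add: power3_eq_cube)
qed

text \<open>If both ends had degree 2, branching at \<open>v\<close> would give 5/8 + 3/8 = 1. This
  fixes the surroundings of the edge, and the missing gain comes from a pendant triangle or from a
  vertex that becomes isolated or a leaf in \<open>V - cnb V v\<close>.\<close>

lemma tight_partner_degree: "card (nb V v') = 3" if v: "{v, v'} \<in> M" "card (nb V v) = 2" for v v'
proof (rule ccontr)
  assume n3: "card (nb V v') \<noteq> 3"
  have inV: "v \<in> V" "v' \<in> V" "v \<noteq> v'" "E v v'" "E v' v"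
    using mt_edgeD[OF mt v(1)] by (auto simp: adj_commute)
  have v'2: "card (nb V v') = 2"
    using n3 mindeg[OF inV(2)] tight_max_degree[OF inV(2)] by linarith
  obtain x where x: "nb V v = {v', x}" "v' \<noteq> x"
    using nb_obtain_second[OF tight_finite v(2), of v'] inV by auto
  obtain y where y: "nb V v' = {v, y}" "v \<noteq> y"
    using nb_obtain_second[OF tight_finite v'2, of v] inV by auto
  have xy: "x \<in> V" "y \<in> V" "E v x" "E x v" "E v' y" "E y v'" "x \<noteq> v" "y \<noteq> v'"
    using nb_pairD[OF x(1)] nb_pairD[OF y(1)] by simp_all
  \<comment> \<open>In \<open>V - {u}\<close> the vertex \<open>u'\<close> is a leaf at
    \<open>q\<close>. The branches cost 3/8 for \<open>{u, u', q}\<close>, 1/4 * (3/4)^k for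
    \<open>Y\<close> and 3/8 for \<open>cnb V u\<close>; a third neighbour of \<open>q\<close>
    besides \<open>u\<close> would make the sum 15/16. This is applied from both ends of the
    edge.\<close>
  have second: "nb V q - {u} = {u', q'} \<and> mi (V - {u}) \<le> 5/8 * W V M"
    if u: "{u, u'} \<in> M" "nb V u = {u', p}" "u' \<noteq> p" "nb V u' = {u, q}" "u \<noteq> q" "{q, q'} \<in> M"
    for u u' p q q'
  proof -
    have uV: "u \<in> V" "u' \<in> V" "u \<noteq> u'" "p \<in> V" "q \<in> V" "q \<noteq> u'" "E u' q" "E q u'" "q' \<in> V" "E q q'" "q \<noteq> q'"
        "p \<noteq> u"
      using mt_edgeD[OF mt u(1)] mt_edgeD[OF mt u(6)] nb_pairD[OF u(2)] nb_pairD[OF u(4)] by simp_all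
    have q': "q' \<noteq> u" "q' \<noteq> u'"
      using mt_unique[OF mt u(1) u(6)] uV u(5) by (auto simp: doubleton_eq_iff)
    define Y where "Y = insert u (cnb (V - {u}) q)"
    have Y: "Y \<subseteq> V" "u \<in> Y" "u' \<in> Y" "q \<in> Y" "q' \<in> Y"
      using uV q' by (auto simp: Y_def)
    have "card Y = card (nb (V - {u}) q) + 2"
      using tight_finite u(5) by (simp add: Y_def)
    then have rY: "mi (V - Y) \<le> 1/4 * (3/4) ^ k * W V M" if "k + 2 \<le> card (nb (V - {u}) q)" for k
      using mi_remove_two_edges[OF bb mt Y(1) u(1) Y(2,3) u(6) Y(4,5), of k] that q' uV u(5)
      by (auto simp: doubleton_eq_iff)
    have rZ: "mi (V - {u, u', q}) \<le> 3/8 * W V M"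
      using mi_remove_edge[OF bb mt _ u(1), of "{u, u', q}" 1] uV u(5) by simp
    have leaf: "nb (V - {u}) u' = {q}"
      using u(4,5) by (simp add: nb_Diff)
    have "mi (V - {u}) \<le> mi (V - {u} - {u', q}) + mi (V - {u} - cnb (V - {u}) q)"
      using tight_finite uV leaf by (intro mi_leaf) auto
    moreover have "V - {u} - {u', q} = V - {u, u', q}" "V - {u} - cnb (V - {u}) q = V - Y"
      by (auto simp: Y_def)
    ultimately have "mi (V - {u}) \<le> mi (V - {u, u', q}) + mi (V - Y)"
      by (simp only:)
    then have leafb: "mi (V - {u}) \<le> 3/8 * W V M + mi (V - Y)"
      using rZ by linarith
    have Nu: "mi (V - cnb V u) \<le> 3/8 * W V M"
      using tight_remove_cnb[OF uV(1), of 1] u(2,3) by simp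
    have sub: "{u', q'} \<subseteq> nb (V - {u}) q"
      using uV q' by auto
    then have c2: "2 \<le> card (nb (V - {u}) q)"
      using card_ge[of "{u', q'}" "nb (V - {u}) q" 2] tight_finite q' by simp
    have "\<not> 3 \<le> card (nb (V - {u}) q)"
    proof
      assume "3 \<le> card (nb (V - {u}) q)"
      then have "mi (V - Y) \<le> 3/16 * W V M"
        using rY[of 1] by simp
      then show False
        using tight_branch[OF uV(1)] leafb Nu tight W_pos[of V M] by linarith
    qed
    then have e2: "card (nb (V - {u}) q) = 2"
      using c2 by linarith
    have "nb (V - {u}) q = {u', q'}"
      using nb_eq_pair[OF _ e2, of u' q'] tight_finite sub q' by simp
    moreover have "mi (V - Y) \<le> 1/4 * W V M"
      using rY[of 0] c2 by simp
    ultimately show ?thesis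
      using leafb by (simp add: nb_Diff)
  qed
  obtain x' where x': "{x, x'} \<in> M"
    using tight_partner[OF xy(1)] by blast
  obtain y' where y': "{y, y'} \<in> M"
    using tight_partner[OF xy(2)] by blast
  have v'v: "{v', v} \<in> M"
    using v(1) by (simp add: insert_commute)
  have ny: "nb V y - {v} = {v', y'}" and dv: "mi (V - {v}) \<le> 5/8 * W V M"
    using second[OF v(1) x y y'] by auto
  have nx: "nb V x - {v'} = {v, x'}"
    using second[OF v'v y(1,2) x(1) x(2) x'] by auto
  have y'V: "y' \<noteq> v" "y' \<noteq> v'" "y' \<in> V" "y \<noteq> y'" "E y y'" "E y' y"
    using mt_unique[OF mt v(1) y'] mt_edgeD[OF mt y'] xy y(2) by (auto simp: doubleton_eq_iff adj_commute)
  show False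
  proof (cases "x = y")
    case True
    have "nb V x = {v, v', y'}"
      using ny True xy inV(1) insert_Diff[of v "nb V y"] by simp
    then have "mi V < W V M"
      using pendant_triangle_strict[OF bb mt perfect mindeg tight_max_degree no_D6 v(1), of x y'] True x y y' y'V
      by auto
    then show False
      using tight by simp
  next
    case False
    then have nyv: "\<not> E v y" "\<not> E v' x"
      using not_adj_if_nb_eq[OF x(1) xy(2)] not_adj_if_nb_eq[OF y(1) xy(1)] xy by simp_all
    then have "v \<notin> nb V y" "v' \<notin> nb V x"
      by (auto dest: adj_sym)
    then have ny': "nb V y = {v', y'}" and nx': "nb V x = {v, x'}"
      using ny nx by simp_all
    define H where "H = V - {v, v', x}"
    have bbH: "bounded_below H"
      unfolding H_def using bb by (rule bounded_below_Diff)
    have mtH: "mt H (del {v, v', x} M)"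
      unfolding H_def using mt by (rule mt_del)
    have WH: "W H (del {v, v', x} M) \<le> 3/8 * W V M"
      using W_remove[OF tight_finite mt, of "{v, v', x}" "{{v, v'}}" "{}" 1] v(1) inV xy x by (simp add: H_def)
    have yH: "y \<in> H"
      using xy False y by (auto simp: H_def)
    have nyH: "nb H y = {y'} - {x}"
      using ny' y'V by (auto simp: H_def nb_Diff)
    have "cnb V v = {v, v', x}"
      using x by simp
    then have b: "mi V \<le> 5/8 * W V M + mi H"
      using tight_branch[OF inV(1)] dv by (simp add: H_def)
    \<comment> \<open>In \<open>H\<close> only \<open>y'\<close> can remain as a neighbour of
      \<open>y\<close>. If \<open>y' = x\<close>, then \<open>y\<close> is isolated; otherwise it is
      a leaf, and 7/8 * 3/8 = 21/64 < 3/8.\<close>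
    have "mi H \<le> 21/64 * W V M"
    proof (cases "y' = x")
      case True
      have "V - {v, v', x} - {y} = V - {v, v', x, y}"
        by auto
      then have "mi H \<le> mi (V - {v, v', x, y})"
        using mi_isolated[of H y] yH nyH True tight_finite by (simp add: H_def)
      also have "\<dots> \<le> 1/4 * W V M"
        using mi_remove_two_edges[OF bb mt _ v(1) _ _ y', of "{v, v', x, y}" 0] inV xy x y False True
        by (auto simp: doubleton_eq_iff)
      finally show ?thesis
        using W_pos[of V M] by linarith
    next
      case y'x: False
      have "x' \<noteq> y'"
        using mt_unique[OF mt x' y', of x'] False y'x by (auto simp: doubleton_eq_iff)
      then have "\<not> E v y'" "\<not> E v' y'" "\<not> E x y'"
        using not_adj_if_nb_eq[OF x(1) y'V(3)] not_adj_if_nb_eq[OF y(1) y'V(3)]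
          not_adj_if_nb_eq[OF nx' y'V(3)] y'V y'x by simp_all
      then have "nb H y' = nb V y'"
        by (auto simp: H_def nb_Diff adj_commute)
      then have "mi H \<le> 7/8 * W H (del {v, v', x} M)"
        using mi_leaf_bound[OF bbH mtH yH, of y' 1] nyH y'x mindeg[OF y'V(3)] by simp
      then show ?thesis
        using WH by linarith
    qed
    then show False
      using b tight W_pos[of V M] by linarith
  qed
qed

text \<open>Let \<open>v\<close> have degree 2 and let \<open>x\<close> be its neighbour other than
  its partner. If \<open>x\<close> has degree 3, the branches over \<open>cnb V v\<close> sum to 3/8
  + 9/32 + 9/32 = 15/16. If it has degree 2, it is a leaf of \<open>V - {v}\<close> at a partner of
  degree 3, and 25/32 * 3/4 + 3/8 = 123/128.\<close>

lemma tight_cubic: "card (nb V v) = 3" if v: "v \<in> V" for v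
proof (rule ccontr)
  assume "card (nb V v) \<noteq> 3"
  then have v2: "card (nb V v) = 2"
    using mindeg[OF v] tight_max_degree[OF v] by linarith
  obtain v' where v': "{v, v'} \<in> M"
    using tight_partner[OF v] by blast
  have v'3: "card (nb V v') = 3"
    using tight_partner_degree[OF v' v2] .
  have inV: "v' \<in> V" "v \<noteq> v'" "E v v'"
    using mt_edgeD[OF mt v'] by auto
  obtain x where x: "nb V v = {v', x}" "v' \<noteq> x"
    using nb_obtain_second[OF tight_finite v2, of v'] inV by auto
  have xV: "x \<in> V" "E v x" "E x v" "x \<noteq> v"
    using nb_pairD[OF x(1)] by simp_all
  have Nv: "mi (V - cnb V v) \<le> 3/8 * W V M"
    using tight_remove_cnb[OF v, of 1] v2 by simp
  have Nv': "mi (V - cnb V v') \<le> 9/32 * W V M"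
    using tight_remove_cnb[OF inV(1), of 2] v'3 by (simp add: power2_eq_square)
  show False
  proof (cases "card (nb V x) = 3")
    case True
    then have "mi (V - cnb V x) \<le> 9/32 * W V M"
      using tight_remove_cnb[OF xV(1), of 2] by (simp add: power2_eq_square)
    then show False
      using mi_deg2[OF tight_finite v x] Nv Nv' tight W_pos[of V M] by linarith
  next
    case False
    then have x2: "card (nb V x) = 2"
      using mindeg[OF xV(1)] tight_max_degree[OF xV(1)] by linarith
    obtain x' where x': "{x, x'} \<in> M"
      using tight_partner[OF xV(1)] by blast
    have x'V: "x' \<in> V" "E x x'" "x \<noteq> x'"
      using mt_edgeD[OF mt x'] by auto
    have "x' \<noteq> v" "x' \<noteq> v'"
      using mt_unique[OF mt v' x'] x xV by (auto simp: doubleton_eq_iff)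
    then have "\<not> E v x'" "\<not> E x' v"
      using not_adj_if_nb_eq[OF x(1) x'V(1)] x'V by simp_all
    then have n: "nb (V - {v}) x' = nb V x'"
      by (auto simp: nb_Diff)
    have "nb V x = {v, x'}"
      using nb_eq_pair[OF tight_finite x2, of v x'] v xV x'V \<open>x' \<noteq> v\<close> by simp
    then have l: "nb (V - {v}) x = {x'}"
      using \<open>x' \<noteq> v\<close> by (auto simp: nb_Diff)
    have "mi (V - {v}) \<le> (1/2 + 1/2 * (3/4) ^ 2) * W (V - {v}) (del {v} M)"
      using mi_leaf_bound[OF bounded_below_Diff[OF bb] mt_del[OF mt] _ l, of 2] n
        tight_partner_degree[OF x' x2] xV by simp
    then show False
      using W_remove_vertex[OF tight_finite mt v] tight_branch[OF v] Nv tight W_pos[of V M] by (simp add: power2_eq_square)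
  qed
qed

text \<open>In \<open>V - {v}\<close> only the partner \<open>v'\<close> is unmatched, and it has
  degree 2 there as the graph is cubic, so \<open>free_vertex_degree_two\<close> applies.\<close>

lemma tight_contradiction:
  assumes ne: "V \<noteq> {}" and no_clique: "\<And>C. \<not> clique_comp V C"
  shows False
proof -
  obtain v where v: "v \<in> V"
    using ne by blast
  obtain v' where v': "{v, v'} \<in> M"
    using tight_partner[OF v] by blast
  have inV: "v' \<in> V" "v \<noteq> v'" "E v v'" "E v' v"
    using mt_edgeD[OF mt v'] by (auto simp: adj_commute)
  define H where "H = V - {v}"
  define N where "N = del {v} M"
  have bbH: "bounded_below H" and mtH: "mt H N"
    unfolding H_def N_def using bb mt by (simp_all add: bounded_below_Diff mt_del)
  have UN: "\<Union>N = H - {v'}"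
    unfolding H_def N_def
    by (rule Union_del[OF mt perfect v']) (use inV in auto)
  have v'H: "v' \<in> H"
    using inV by (simp add: H_def)
  have nbH: "nb H u = nb V u - {v}" for u
    by (simp add: H_def nb_Diff)
  have cH: "card (nb H u) = (if E u v then 2 else 3)" if "u \<in> V" for u
    using tight_cubic[OF that] v tight_finite by (simp add: nbH card_Diff_singleton_if)
  obtain a b where ab: "nb H v' = {a, b}" "a \<noteq> b"
    using cH[OF inV(1)] inV(4) by (auto simp: card_2_iff)
  have abH: "a \<in> H" "b \<in> H" "a \<noteq> v'" "b \<noteq> v'" "E v' a" "E v' b"
    using nb_pairD[OF ab(1)] by simp_all
  have WH: "W H N \<le> 3/4 * W V M"
    unfolding H_def N_def using tight_finite mt v by (rule W_remove_vertex)
  have Nv: "mi (V - cnb V v) \<le> 9/32 * W V M"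
    using tight_remove_cnb[OF v, of 2] tight_cubic[OF v] by (simp add: power2_eq_square)
  have mindegH: "2 \<le> card (nb H u)" if "u \<in> H" for u
    using cH[of u] that by (simp add: H_def)
  have "v' \<notin> \<Union>N" "a \<in> \<Union>N" "b \<in> \<Union>N"
    using UN abH by auto
  from free_vertex_degree_two[OF bbH mtH v'H this(1) ab this(2,3) mindegH]
  consider "E a b" "nb H a = {v', b}" "nb H b = {v', a}" | "mi H \<le> 11/12 * W H N"
    | c c' where "mi H \<le> 23/24 * W H N" "c \<in> nb H v'" "{c, c'} \<in> N" "card (nb H c) = 2"
        "card (nb H c') = 2"
    by blast
  then show False
  proof cases
    case 1
    \<comment> \<open>Degree 2 in \<open>H\<close> means adjacency to \<open>v\<close>, so the
      triangle extends to a component \<open>K4\<close>.\<close>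
    have "card (nb H a) = 2" "card (nb H b) = 2"
      using 1 abH by simp_all
    then have Ev: "E a v" "E b v" "E v a" "E v b"
      using cH[of a] cH[of b] abH by (auto simp: H_def adj_commute split: if_splits)
    have nv: "nb V v = {v', a, b}"
      using nb_eq_triple[OF tight_finite tight_cubic[OF v], of v' a b] inV Ev abH ab(2) by (auto simp: H_def)
    have na: "nb V a = {v, v', b}" "nb V b = {v, v', a}" "nb V v' = {v, a, b}"
      using nbH[of a] nbH[of b] nbH[of v'] 1 ab(1) v Ev inV(4) insert_Diff[of v "nb V a"]
        insert_Diff[of v "nb V b"] insert_Diff[of v "nb V v'"] by simp_all
    have "card {v, v', a, b} = 4"
      using inV abH ab(2) by (auto simp: H_def)
    then have "clique_comp V {v, v', a, b}"
      unfolding clique_comp_def using inV(1,2) abH(1-4) ab(2) v by (auto simp: H_def nv na)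
    with no_clique show False
      by blast
  next
    case 2
    \<comment> \<open>11/12 * 3/4 + 9/32 = 31/32.\<close>
    then show False
      using tight_branch[OF v] Nv WH tight W_pos[of V M] unfolding H_def[symmetric] by linarith
  next
    case (3 c c')
    have c: "c \<in> H" "c' \<in> H" "c \<noteq> v'" "{c, c'} \<in> M" "c \<noteq> v"
      using 3 mt_edgeD[OF mtH 3(3)] by (auto simp: N_def del_def H_def)
    \<comment> \<open>Both lost a neighbour, so \<open>cnb V v\<close> contains two matching edges,
      and 23/24 * 3/4 + 1/4 = 31/32.\<close>
    then have "E v c" "E v c'"
      using 3 cH[of c] cH[of c'] by (auto simp: H_def adj_commute split: if_splits)
    then have "mi (V - cnb V v) \<le> 1/4 * W V M"
      using mi_remove_two_edges[OF bb mt cnb_subset[OF v] v' _ _ c(4), of 0] c v inV tight_cubic[OF v] tight_finite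
      by (auto simp: H_def doubleton_eq_iff)
    then show False
      using tight_branch[OF v] 3(1) WH tight W_pos[of V M] unfolding H_def[symmetric] by linarith
  qed
qed

end

lemma perfect_strict:
  assumes "bounded_below V" "mt V M" "\<Union>M = V" "V \<noteq> {}"
    and "\<And>u. u \<in> V \<Longrightarrow> 2 \<le> card (nb V u)"
    and "\<And>C. \<not> clique_comp V C" "\<And>C. \<not> D6_comp V C"
  shows "mi V < W V M"
proof (rule ccontr)
  assume "\<not> mi V < W V M"
  then have "W V M \<le> mi V"
    by simp
  then show False
    using assms by (intro tight_contradiction[of V M]) simp_all
qed

section \<open>Induction over the components\<close>

text \<open>An isolated vertex, a leaf, an unmatched vertex or a perfect matching each gives a
  strict gain. The hypothesis \<open>maximal\<close> makes the neighbours of an unmatched vertex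
  matched, as \<open>free_vertex_degree_two\<close> requires.\<close>

lemma no_component_strict:
  assumes bb: "bounded_below V" and mt: "mt V M" and ne: "V \<noteq> {}"
    and maximal: "\<And>x y. x \<in> V \<Longrightarrow> y \<in> V \<Longrightarrow> E x y \<Longrightarrow> x \<in> \<Union>M \<or> y \<in> \<Union>M"
    and no_clique: "\<And>C. \<not> clique_comp V C" and no_D6: "\<And>C. \<not> D6_comp V C"
  shows "mi V < W V M"
proof -
  have fV: "finite V"
    using bb by (simp add: bounded_below_def)
  have W0: "0 < W V M"
    by simp
  consider (isolated) v where "v \<in> V" "card (nb V v) = 0" | (leaf) v where "v \<in> V" "card (nb V v) = 1"
    | (free) v where "v \<in> V" "v \<notin> \<Union>M" "\<And>u. u \<in> V \<Longrightarrow> 2 \<le> card (nb V u)"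
    | (perfect) "V \<subseteq> \<Union>M" "\<And>u. u \<in> V \<Longrightarrow> 2 \<le> card (nb V u)"
  proof (cases "\<forall>u\<in>V. 2 \<le> card (nb V u)")
    case True
    then show thesis
      using free perfect by (cases "V \<subseteq> \<Union>M") blast+
  next
    case False
    then obtain v where "v \<in> V" "card (nb V v) < 2"
      by auto
    then show thesis
      using isolated leaf by (cases "card (nb V v) = 0") auto
  qed
  then show ?thesis
  proof cases
    case (isolated v)
    then have "mi V \<le> mi (V - {v})"
      using fV by (intro mi_isolated) auto
    also have "\<dots> \<le> 3/4 * W V M"
      using mi_remove[OF bb mt, of "{v}" "{}" "{}" 1] isolated by simp
    finally show ?thesis
      using W0 by linarith
  next
    case (leaf v)
    then obtain z where z: "nb V v = {z}"
      by (auto simp: card_1_singleton_iff)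
    have zV: "z \<in> V" "E v z" "E z v" "v \<noteq> z"
      using nb_pairD[of V v z z] z by auto
    show ?thesis
    proof (cases "2 \<le> card (nb V z)")
      case True
      then have "mi V \<le> 7/8 * W V M"
        using mi_leaf_bound[OF bb mt leaf(1) z, of 1] by simp
      then show ?thesis
        using W0 by linarith
    next
      case False
      have "nb V z = {v}"
        using card_seteq[of "nb V z" "{v}"] False fV zV leaf(1) by auto
      then have "clique_comp V {v, z}"
        unfolding clique_comp_def using z zV leaf(1) by auto
      with no_clique show ?thesis
        by blast
    qed
  next
    case (free v)
    show ?thesis
    proof (cases "card (nb V v) = 2")
      case False
      then have "3 \<le> card (nb V v)"
        using free(3)[OF free(1)] by linarith
      \<comment> \<open>2/3 + 2/3 * (3/4)^3 = 91/96.\<close>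
      then have "mi (V - cnb V v) \<le> 9/32 * W V M"
        using mi_remove_free[OF bb mt cnb_subset[OF free(1)] _ free(2), of 3] fV
        by (simp add: power3_eq_cube)
      moreover have "mi (V - {v}) \<le> 2/3 * W V M"
        using mi_remove_free[OF bb mt, of "{v}" v 0] free by simp
      ultimately show ?thesis
        using mi_branch_vertex[OF fV free(1)] W0 by linarith
    next
      case True
      then obtain a b where ab: "nb V v = {a, b}" "a \<noteq> b"
        by (auto simp: card_2_iff)
      note n = nb_pairD[OF ab(1)]
      have "a \<in> \<Union>M" "b \<in> \<Union>M"
        using maximal[OF free(1) n(1) n(3)] maximal[OF free(1) n(2) n(4)] free(2) by auto
      from free_vertex_degree_two[OF bb mt free(1,2) ab this free(3)]
      consider "nb V a = {v, b}" "nb V b = {v, a}" | "mi V \<le> 11/12 * W V M" | "mi V \<le> 23/24 * W V M"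
        by blast
      then show ?thesis
      proof cases
        case 1
        have "card {v, a, b} = 3"
          using n ab(2) by simp
        then have "clique_comp V {v, a, b}"
          unfolding clique_comp_def using n(1,2,7,8) ab(2) free(1) by (auto simp: 1 ab(1))
        with no_clique show ?thesis
          by blast
      qed (use W0 in linarith)+
    qed
  next
    case perfect
    moreover have "\<Union>M \<subseteq> V"
      using mt by (auto simp: mt_def)
    ultimately show ?thesis
      using bb mt ne no_clique no_D6 by (intro perfect_strict) auto
  qed
qed

text \<open>Disjoint unions of the exceptional graphs, built one component at a time to match the
  induction.\<close>

inductive blocks :: "'a set \<Rightarrow> bool" where
  empty: "blocks {}"
| component: "clique_comp V C \<or> D6_comp V C \<Longrightarrow> blocks (V - C) \<Longrightarrow> blocks V"

lemma D6_compE: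
  assumes "D6_comp V C"
  obtains a b c d e f where "distinct [a, b, c, d, e, f]" "C = {a, b, c, d, e, f}" "C \<subseteq> V"
    "nb V a = {b, c}" "nb V b = {a, c}" "nb V c = {a, b, d}"
    "nb V d = {c, e, f}" "nb V e = {d, f}" "nb V f = {d, e}"
  using assms unfolding D6_comp_def by (elim exE conjE) (rule that)

lemma component_closed:
  assumes "clique_comp V C \<or> D6_comp V C"
  shows "C \<subseteq> V" "C \<noteq> {}" "x \<in> C \<Longrightarrow> nb V x \<subseteq> C"
proof -
  have "C \<subseteq> V \<and> C \<noteq> {} \<and> (\<forall>x\<in>C. nb V x \<subseteq> C)"
    using assms
  proof
    assume "clique_comp V C"
    then show ?thesis
      unfolding clique_comp_def by auto
  next
    assume "D6_comp V C"
    then obtain a b c d e f where "distinct [a, b, c, d, e, f]" and C: "C = {a, b, c, d, e, f}" "C \<subseteq> V"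
      and nbs: "nb V a = {b, c}" "nb V b = {a, c}" "nb V c = {a, b, d}"
        "nb V d = {c, e, f}" "nb V e = {d, f}" "nb V f = {d, e}"
      by (rule D6_compE)
    show ?thesis
      using C(2) unfolding C(1) by (simp add: nbs)
  qed
  then show "C \<subseteq> V" "C \<noteq> {}" "x \<in> C \<Longrightarrow> nb V x \<subseteq> C"
    by blast+
qed

text \<open>A matching edge that meets \<open>C\<close> lies inside \<open>C\<close>, so at most
  half of \<open>card C\<close> edges are lost.\<close>

lemma W_remove_component:
  assumes fV: "finite V" and mt: "mt V M" and C: "C \<subseteq> V" "\<And>x. x \<in> C \<Longrightarrow> nb V x \<subseteq> C"
  shows "W (V - C) (del C M) \<le> (2/3) ^ card C * (9/8) ^ (card C div 2) * W V M"
proof (rule W_del[OF fV mt C(1)])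
  let ?T = "{e \<in> M. e \<inter> C \<noteq> {}}"
  have "e \<subseteq> C" if "e \<in> M" and c: "e \<inter> C \<noteq> {}" for e
  proof -
    obtain x where x: "x \<in> e" "x \<in> C"
      using c by blast
    then obtain y where "e = {x, y}"
      using mt \<open>e \<in> M\<close> by (auto simp: mt_def dest!: bspec)
    then show ?thesis
      using C(2)[OF x(2)] mt_edgeD[OF mt, of x y] \<open>e \<in> M\<close> x by auto
  qed
  then have "card (\<Union>?T) \<le> card C"
    using fV C(1) by (intro card_mono) (auto intro: finite_subset)
  then show "card ?T \<le> card C div 2"
    using card_Union_mt[OF mt, of ?T] fV by simp
qed

text \<open>Besides \<open>V - C\<close>, deleting the bridge end \<open>c\<close> leaves a
  \<open>K2\<close> and a \<open>K3\<close>, and deleting \<open>cnb V c\<close> leaves a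
  \<open>K2\<close>: 2 * 3 + 2 = 8.\<close>

lemma D6_comp_mi:
  assumes fV: "finite V" and "D6_comp V C"
  shows "mi V \<le> 8 * mi (V - C)" "card C = 6"
proof -
  obtain a b c d e f where dist: "distinct [a, b, c, d, e, f]" and C: "C = {a, b, c, d, e, f}" "C \<subseteq> V"
    and nbs: "nb V a = {b, c}" "nb V b = {a, c}" "nb V c = {a, b, d}"
      "nb V d = {c, e, f}" "nb V e = {d, f}" "nb V f = {d, e}"
    using assms(2) by (rule D6_compE)
  show "card C = 6"
    using dist C(1) by simp
  have "mi (V - {c}) \<le> real (card {a, b}) * mi (V - {c} - {a, b})"
    using fV dist C(2) unfolding C(1) by (intro mi_clique_component) (auto simp: nb_Diff nbs)
  moreover have "mi (V - {c} - {a, b}) \<le> real (card {d, e, f}) * mi (V - {c} - {a, b} - {d, e, f})"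
    using fV dist C(2) unfolding C(1) by (intro mi_clique_component) (auto simp: nb_Diff nbs)
  moreover have "V - {c} - {a, b} - {d, e, f} = V - C"
    using C(1) by auto
  moreover have "card {a, b} = 2" "card {d, e, f} = 3" "card {e, f} = 2"
    using dist by simp_all
  moreover have "mi (V - cnb V c) \<le> real (card {e, f}) * mi (V - cnb V c - {e, f})"
    using fV dist C(2) unfolding C(1) by (intro mi_clique_component) (auto simp: nb_Diff nbs)
  moreover have "V - cnb V c - {e, f} = V - C"
    unfolding C(1) nbs by auto
  moreover have "mi V \<le> mi (V - {c}) + mi (V - cnb V c)"
    using fV C by (intro mi_branch_vertex) auto
  ultimately show "mi V \<le> 8 * mi (V - C)"
    by simp
qed

text \<open>The constant \<open>k\<close> is 2, 3, 4 or 8, the number of maximal independent sets of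
  the component, and its product with the factor of \<open>W_remove_component\<close> is exactly 1.
  Hence bounds on \<open>V - C\<close>, strict or not, carry over to \<open>V\<close>.\<close>

lemma component_bound:
  assumes fV: "finite V" and C: "clique_comp V C \<or> D6_comp V C"
  obtains k :: real where "0 < k" "mi V \<le> k * mi (V - C)"
    "\<And>M. mt V M \<Longrightarrow> k * W (V - C) (del C M) \<le> W V M"
proof -
  note cl = component_closed[OF C] and result = that
  have *: thesis if k: "0 < k" "mi V \<le> k * mi (V - C)" "k * ((2/3) ^ card C * (9/8) ^ (card C div 2)) \<le> 1" for k
  proof (rule result[OF k(1,2)])
    fix M
    assume mt: "mt V M"
    have "k * W (V - C) (del C M) \<le> k * ((2/3) ^ card C * (9/8) ^ (card C div 2) * W V M)"
      using k(1) W_remove_component[OF fV mt cl(1,3)] by (intro mult_left_mono) auto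
    also have "\<dots> = k * ((2/3) ^ card C * (9/8) ^ (card C div 2)) * W V M"
      by (simp only: mult_ac)
    also have "\<dots> \<le> 1 * W V M"
      using k(3) less_imp_le[OF W_pos[of V M]] by (rule mult_right_mono)
    finally show "k * W (V - C) (del C M) \<le> W V M"
      by simp
  qed
  show thesis
  proof (cases "D6_comp V C")
    case True
    then show thesis
      using D6_comp_mi[OF fV True] by (intro *[of 8]) (simp_all add: power_divide)
  next
    case False
    then have cc: "clique_comp V C"
      using C by blast
    then have "mi V \<le> real (card C) * mi (V - C)"
      using fV cl(1,2) unfolding clique_comp_def by (intro mi_clique_component) auto
    moreover have "card C \<in> {2, 3, 4}"
      using cc by (simp add: clique_comp_def)
    ultimately show thesis
      by (intro *[of "real (card C)"]) (auto simp: power_divide)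
  qed
qed

text \<open>A largest matching works, since an uncovered edge could be added to it.\<close>

lemma maximal_matching_above:
  assumes fV: "finite V" and "mt V M"
  obtains N where "mt V N" "card M \<le> card N"
    "\<And>x y. x \<in> V \<Longrightarrow> y \<in> V \<Longrightarrow> E x y \<Longrightarrow> x \<in> \<Union>N \<or> y \<in> \<Union>N"
proof -
  have "card N \<le> card (Pow V)" if "mt V N" for N
    using that fV by (intro card_mono) (auto simp: mt_def)
  then have "\<forall>N. mt V N \<longrightarrow> card N < Suc (card (Pow V))"
    by (simp add: less_Suc_eq_le)
  then obtain N where N: "mt V N" "\<And>N'. mt V N' \<Longrightarrow> card N' \<le> card N"
    using ex_has_greatest_nat[of "mt V" M card] assms(2) by blast
  have "x \<in> \<Union>N \<or> y \<in> \<Union>N" if xy: "x \<in> V" "y \<in> V" "E x y" for x y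
  proof (rule ccontr)
    assume free: "\<not> (x \<in> \<Union>N \<or> y \<in> \<Union>N)"
    then have "mt V (insert {x, y} N)"
      using N(1) xy unfolding mt_def by (auto simp: pairwise_insert disjnt_iff)
    then have "card (insert {x, y} N) \<le> card N"
      by (rule N(2))
    moreover have "{x, y} \<notin> N" "finite N"
      using free mt_finite[OF N(1) fV] by auto
    ultimately show False
      by simp
  qed
  with N assms(2) that show thesis
    by blast
qed

lemma mi_le_W:
  assumes "finite V" "mt V M"
  shows "mi V \<le> W V M \<and> (\<not> blocks V \<longrightarrow> mi V < W V M)"
  using assms
proof (induction V arbitrary: M rule: finite_psubset_induct)
  case (psubset V)
  show ?case
  proof (cases "\<exists>C. clique_comp V C \<or> D6_comp V C")
    case True
    then obtain C where C: "clique_comp V C \<or> D6_comp V C"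
      by blast
    obtain k where k: "0 < k" "mi V \<le> k * mi (V - C)" "k * W (V - C) (del C M) \<le> W V M"
      using component_bound[OF psubset(1) C] psubset(3) by metis
    have "V - C \<subset> V"
      using component_closed[OF C] by blast
    then have IH: "mi (V - C) \<le> W (V - C) (del C M)"
        "\<not> blocks (V - C) \<Longrightarrow> mi (V - C) < W (V - C) (del C M)"
      using psubset(2) mt_del[OF psubset(3)] by auto
    have "mi V \<le> W V M"
      using mult_left_mono[OF IH(1), of k] k by linarith
    moreover have "mi V < W V M" if "\<not> blocks V"
    proof -
      have "\<not> blocks (V - C)"
        using that blocks.component[OF C] by blast
      from mult_strict_left_mono[OF IH(2)[OF this] k(1)] k show ?thesis
        by linarith
    qed
    ultimately show ?thesis
      by blast
  next
    case False
    show ?thesis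
    proof (cases "V = {}")
      case True
      then have "M = {}"
        using psubset(3) by (auto simp: mt_def)
      then show ?thesis
        using True mi_empty blocks.empty by (simp add: W_def)
    next
      case ne: False
      obtain N where N: "mt V N" "card M \<le> card N"
          "\<And>x y. x \<in> V \<Longrightarrow> y \<in> V \<Longrightarrow> E x y \<Longrightarrow> x \<in> \<Union>N \<or> y \<in> \<Union>N"
        using maximal_matching_above[OF psubset(1,3)] by blast
      have "bounded_below V"
        using psubset unfolding bounded_below_def by blast
      then have "mi V < W V N"
        using N ne False by (intro no_component_strict) auto
      \<comment> \<open>As 8/9 < 1, a larger matching only sharpens the bound.\<close>
      also have "W V N \<le> W V M"
        unfolding W_def using N(2) by (intro mult_left_mono power_decreasing) auto
      finally show ?thesis
        by simp
    qed
  qed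
qed

section \<open>Components as copies of the named graphs\<close>

definition ind :: "'a set \<Rightarrow> 'a ugraph" where
  "ind V = \<lparr>verts = V, edges = (\<Union>x\<in>V. (\<lambda>y. {x, y}) ` nb V x)\<rparr>"

lemma verts_ind [simp]: "verts (ind V) = V"
  by (simp add: ind_def)

text \<open>On both sides the edges are all two-element subsets, so any bijection of the vertices
  works.\<close>

lemma clique_comp_iso:
  assumes fV: "finite V" and C: "clique_comp V C"
  shows "graph_iso (complete_graph (card C)) (ind C)"
proof -
  have "finite C"
    using C fV finite_subset by (auto simp: clique_comp_def)
  then obtain h where h: "bij_betw h {..<card C} C"
    using ex_bij_betw_nat_finite[of C] by (auto simp: atLeast0LessThan)
  have inj: "inj_on h {..<card C}" and im: "h ` {..<card C} = C"
    using h by (auto simp: bij_betw_def)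
  have nbC: "nb C x = C - {x}" if "x \<in> C" for x
  proof -
    have "nb V x = C - {x}" "C \<subseteq> V"
      using C that by (auto simp: clique_comp_def)
    moreover have "nb C x = nb V x \<inter> C"
      using \<open>C \<subseteq> V\<close> by (auto simp: nb_def)
    ultimately show ?thesis
      by auto
  qed
  have "edges (ind C) = (\<Union>x\<in>C. (\<lambda>y. {x, y}) ` (C - {x}))"
    unfolding ind_def by (simp add: nbC)
  also have "\<dots> = {e. e \<subseteq> C \<and> card e = 2}"
    by (auto simp: card_2_iff)
  also have "\<dots> = (\<lambda>e. h ` e) ` {e. e \<subseteq> {..<card C} \<and> card e = 2}"
  proof (intro equalityI subsetI)
    fix e
    assume "e \<in> {e. e \<subseteq> C \<and> card e = 2}"
    then obtain e' where "e' \<subseteq> {..<card C}" "e = h ` e'" "card e = 2"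
      using im subset_image_iff[of e h "{..<card C}"] by auto
    moreover from this have "card e' = 2"
      using card_image[OF inj_on_subset[OF inj]] by simp
    ultimately show "e \<in> (\<lambda>e. h ` e) ` {e. e \<subseteq> {..<card C} \<and> card e = 2}"
      by blast
  next
    fix e
    assume "e \<in> (\<lambda>e. h ` e) ` {e. e \<subseteq> {..<card C} \<and> card e = 2}"
    then obtain e' where e': "e' \<subseteq> {..<card C}" "e = h ` e'" "card e' = 2"
      by blast
    then have "card e = 2"
      using card_image[OF inj_on_subset[OF inj e'(1)]] by simp
    then show "e \<in> {e. e \<subseteq> C \<and> card e = 2}"
      using e' im by blast
  qed
  finally show ?thesis
    unfolding graph_iso_def using h by (auto simp: complete_graph_def)
qed

lemma D6_comp_iso:
  assumes "D6_comp V C"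
  shows "graph_iso D6 (ind C)"
proof -
  obtain a b c d e f where dist: "distinct [a, b, c, d, e, f]" and C: "C = {a, b, c, d, e, f}" "C \<subseteq> V"
    and nbs: "nb V a = {b, c}" "nb V b = {a, c}" "nb V c = {a, b, d}"
      "nb V d = {c, e, f}" "nb V e = {d, f}" "nb V f = {d, e}"
    using assms by (rule D6_compE)
  \<comment> \<open>The list follows the numbering of \<open>D6\<close>: positions 2 and 3 hold the
    ends of the bridge.\<close>
  define h where "h = (!) [a, b, c, d, e, f]"
  have h: "h 0 = a" "h 1 = b" "h 2 = c" "h 3 = d" "h 4 = e" "h 5 = f"
    by (simp_all add: h_def)
  have "bij_betw h {..<6} C"
    unfolding h_def by (rule bij_betw_nth) (use dist C(1) in auto)
  moreover have "nb C x = nb V x" if "x \<in> C" for x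
    using component_closed(3)[OF disjI2[OF assms] that] C(2) by (auto simp: nb_def)
  then have "edges (ind C) = (\<Union>x\<in>C. (\<lambda>y. {x, y}) ` nb V x)"
    unfolding ind_def by simp
  then have "edges (ind C) = {{a, b}, {a, c}, {b, c}, {d, e}, {d, f}, {e, f}, {c, d}}"
    unfolding C(1) by (simp add: nbs insert_commute)
  then have "edges (ind C) = (\<lambda>x. h ` x) ` edges D6"
    by (simp add: D6_def h[simplified] insert_commute)
  ultimately show ?thesis
    unfolding graph_iso_def by (auto simp: D6_def)
qed

lemma blocks_disjoint_union:
  assumes "blocks V" "finite V"
  shows "disjoint_union_of_copies {complete_graph 2, complete_graph 3, complete_graph 4, D6} (ind V)"
  using assms
proof (induction V rule: blocks.induct)
  case empty
  show ?case
    unfolding disjoint_union_of_copies_def by (intro exI[of _ "{}"]) (simp add: ind_def)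
next
  case (component V C)
  let ?\<H> = "{complete_graph 2, complete_graph 3, complete_graph 4, D6}"
  obtain F where F: "\<forall>A\<in>F. \<exists>H\<in>?\<H>. graph_iso H A" "pairwise (\<lambda>A B. disjnt (verts A) (verts B)) F"
      "V - C = (\<Union>A\<in>F. verts A)" "edges (ind (V - C)) = (\<Union>A\<in>F. edges A)"
    using component unfolding disjoint_union_of_copies_def by auto
  note cl = component_closed[OF component(1)]
  have "\<exists>H\<in>?\<H>. graph_iso H (ind C)"
  proof (cases "D6_comp V C")
    case True
    then show ?thesis
      using D6_comp_iso by blast
  next
    case False
    then have "clique_comp V C"
      using component(1) by blast
    then show ?thesis
      using clique_comp_iso[OF component(4), of C] by (force simp: clique_comp_def)
  qed
  moreover have "disjnt C (verts A)" if "A \<in> F" for A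
    using F(3) that by (auto simp: disjnt_iff)
  then have "pairwise (\<lambda>A B. disjnt (verts A) (verts B)) (insert (ind C) F)"
    using F(2) by (auto simp: pairwise_insert disjnt_sym)
  moreover have "V = (\<Union>A\<in>insert (ind C) F. verts A)"
    using F(3) cl(1) by auto
  \<comment> \<open>No edge joins \<open>C\<close> to \<open>V - C\<close>, so the edge set
    splits.\<close>
  moreover have "edges (ind V) = (\<Union>A\<in>insert (ind C) F. edges A)"
  proof -
    have "nb C x = nb V x" if "x \<in> C" for x
      using cl(1) cl(3)[OF that] by (auto simp: nb_def)
    moreover have "nb (V - C) x = nb V x" if x: "x \<in> V - C" for x
    proof -
      have "y \<notin> C" if "y \<in> nb V x" for y
      proof
        assume "y \<in> C"
        moreover have "x \<in> nb V y"
          using that x adj_sym by auto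
        ultimately show False
          using cl(3) x by blast
      qed
      then show ?thesis
        by (auto simp: nb_Diff)
    qed
    moreover have "V = C \<union> (V - C)"
      using cl(1) by blast
    ultimately have "edges (ind V) = edges (ind C) \<union> edges (ind (V - C))"
      unfolding ind_def by (simp add: UN_Un[symmetric])
    then show ?thesis
      using F(4) by simp
  qed
  ultimately show ?case
    unfolding disjoint_union_of_copies_def using F(1) by (intro exI[of _ "insert (ind C) F"]) auto
qed

end

section \<open>Transfer to the given graph and its matching number\<close>

theorem theorem2p2:
  fixes G :: "'a ugraph" and n m :: nat
  assumes "simple_graph G"
    and "card (verts G) = n"
    and "matching_number G = m"
    and "\<not> disjoint_union_of_copies
           {complete_graph 2, complete_graph 3, complete_graph 4, D6} G"
  shows "real (mis G) < 2 powi (3 * int m - int n) * 3 powi (int n - 2 * int m)"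
proof -
  define E where "E = (\<lambda>x y. {x, y} \<in> edges G)"
  interpret adjacency E
    using assms(1) by unfold_locales (auto simp: E_def simple_graph_def insert_commute)
  have fin: "finite (verts G)" and edge: "\<And>e. e \<in> edges G \<Longrightarrow> e \<subseteq> verts G \<and> card e = 2"
    using assms(1) by (auto simp: simple_graph_def)
  have edge_pair: "\<exists>x y. e = {x, y} \<and> x \<in> verts G \<and> y \<in> verts G \<and> E x y" if "e \<in> edges G" for e
    using edge[OF that] that unfolding card_2_iff E_def by auto
  have "edges (ind (verts G)) = edges G"
  proof (intro equalityI subsetI)
    fix e
    assume "e \<in> edges (ind (verts G))"
    then obtain x y where "e = {x, y}" "E x y"
      by (auto simp: ind_def)
    then show "e \<in> edges G"
      by (simp add: E_def)
  next
    fix e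
    assume "e \<in> edges G"
    then obtain x y where "e = {x, y}" "x \<in> verts G" "y \<in> verts G" "E x y"
      using edge_pair by blast
    then have xy: "e = {x, y}" "x \<in> verts G" "y \<in> nb (verts G) x"
      by simp_all
    have "e \<in> (\<lambda>y. {x, y}) ` nb (verts G) x"
      using xy(1,3) by (rule image_eqI)
    then show "e \<in> edges (ind (verts G))"
      using xy(2) by (auto simp: ind_def)
  qed
  then have G: "ind (verts G) = G"
    by (intro ugraph.equality) simp_all
  \<comment> \<open>Maximality under inclusion amounts to domination: an undominated vertex could be
    added, while a larger independent set would contain a dominated vertex.\<close>
  have "maximal_independent_set G S \<longleftrightarrow> S \<in> misets (verts G)" for S
  proof
    assume S: "maximal_independent_set G S"
    have "\<exists>u\<in>S. E x u" if x: "x \<in> verts G - S" for x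
    proof (rule ccontr)
      assume "\<not> (\<exists>u\<in>S. E x u)"
      then have no: "{x, u} \<notin> edges G" "{u, x} \<notin> edges G" if "u \<in> S" for u
        using that by (auto simp: E_def insert_commute)
      have "{x, x} \<notin> edges G"
        using adj_irrefl[of x] by (simp add: E_def)
      moreover have "independent_set G S"
        using S by (simp add: maximal_independent_set_def)
      ultimately have "independent_set G (insert x S)"
        using x no unfolding independent_set_def by blast
      then have "insert x S = S"
        using S unfolding maximal_independent_set_def by blast
      then show False
        using x by blast
    qed
    moreover have "S \<subseteq> verts G \<and> (\<forall>u\<in>S. \<forall>w\<in>S. \<not> E u w)"
      using S by (simp add: maximal_independent_set_def independent_set_def E_def)
    ultimately show "S \<in> misets (verts G)"
      unfolding misets_def by blast
  next
    assume S: "S \<in> misets (verts G)"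
    have "T = S" if T: "independent_set G T" "S \<subseteq> T" for T
    proof (rule ccontr)
      assume "T \<noteq> S"
      then obtain x where x: "x \<in> T" "x \<notin> S"
        using T(2) by blast
      then have "x \<in> verts G - S"
        using T(1) by (auto simp: independent_set_def)
      then obtain u where "u \<in> S" "E x u"
        using S unfolding misets_def by blast
      then show False
        using T x by (auto simp: independent_set_def E_def)
    qed
    moreover have "independent_set G S"
      using S unfolding misets_def independent_set_def by (simp add: E_def)
    ultimately show "maximal_independent_set G S"
      unfolding maximal_independent_set_def by blast
  qed
  then have mis: "real (mis G) = mi (verts G)"
    by (simp add: mis_def mi_def)
  have "finite (edges G)"
    using edge fin by (intro finite_subset[of "edges G" "Pow (verts G)"]) auto
  then have "finite {M. matching G M}"
    by (intro finite_subset[of "{M. matching G M}" "Pow (edges G)"]) (auto simp: matching_def)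
  moreover have "matching G {}"
    by (simp add: matching_def)
  \<comment> \<open>The empty matching makes the set nonempty, so the maximum is attained.\<close>
  ultimately have "Max {card M | M. matching G M} \<in> {card M | M. matching G M}"
    by (intro Max_in) auto
  then obtain M where M: "matching G M" "card M = m"
    using assms(3) by (auto simp: matching_number_def)
  have "mt (verts G) M"
    using M(1) edge_pair unfolding mt_def matching_def by blast
  moreover have "\<not> blocks (verts G)"
    using blocks_disjoint_union fin assms(4) G by force
  ultimately have "mi (verts G) < W (verts G) M"
    using mi_le_W fin by blast
  also have "W (verts G) M = (3/2) ^ n * (8/9) ^ m"
    by (simp add: W_def assms(2) M(2))
  \<comment> \<open>The powers of 2 and 3 are collected; integer exponents are needed as 3m - n may
    be negative.\<close>
  also have "\<dots> = 2 powi (3 * int m - int n) * 3 powi (int n - 2 * int m)"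
    by (simp add: power_int_diff power_int_mult power_divide)
  finally show ?thesis
    unfolding mis .
qed

end
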